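(* Let $\xi\geq 1$ be a countable ordinal. Then there exists a partial injection $f:\omega^\omega\rightarrow\omega^\omega$ whose domain and range are disjoint, whose graph $\mathrm{Gr}(f)=\{(x,f(x)) : x\in\mathrm{Domain}(f)\}$ is a closed subset of $\omega^\omega\times\omega^\omega$, and such that $\mathrm{Gr}(f)$ has no $\mathbf{\Delta}^0_\xi$-measurable finite coloring. Consequently, $\mathrm{Gr}(f)$ has Borel chromatic number two and $\mathbf{\Delta}^0_\xi$ chromatic number $\aleph_0$.
   Context: $\omega^\omega$ is the Baire space with its usual product topology (of the discrete topology on $\omega$), and $\omega^\omega\times\omega^\omega$ carries the product topology. For a binary relation $B\subseteq X\times X$ on a Polish space $X$, a coloring of $B$ with values in a set $K$ is a map $c:X\rightarrow K$ such that $c(x)\neq c(y)$ whenever $(x,y)\in B$. A finite coloring is a coloring with values in a finite set $\{0,\dots,n-1\}$; it is $\mathbf{\Delta}^0_\xi$-measurable if $c^{-1}(\{k\})$ is a $\mathbf{\Delta}^0_\xi$ subset of $X$ (i.e. both $\mathbf{\Sigma}^0_\xi$ and $\mathbf{\Pi}^0_\xi$ in the Borel hierarchy; for $\xi=1$ this means clopen) for every $k$. The Borel (resp. $\mathbf{\Delta}^0_\xi$) chromatic number of $B$ is the least cardinality of the range of a Borel-measurable (resp. $\mathbf{\Delta}^0_\xi$-measurable) coloring of $B$ with countable range. *)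

theory Defs
  imports "HOL-Analysis.Analysis"
begin

unbundle cardinal_syntax

text \<open>Baire space is the type \<^typ>\<open>nat \<Rightarrow> nat\<close>: \<^typ>\<open>nat\<close> is discrete and the
  library topology on a function type is the product topology.\<close>

type_synonym baire = "nat \<Rightarrow> nat"

text \<open>A countable ordinal is represented by a well-order on a set of natural numbers, and the
  order of ordinals is \<open><o\<close> from the library. Every countable ordinal is
  the order type of such a relation; it is at least 1 iff the field is nonempty, and it is 1
  iff the field is a singleton.

  In the second rule the existence of a nonempty \<open>s <o r\<close> forces \<open>r\<close> to have order type
  greater than 1. The premise says that the set \<open>A n\<close> is in the multiplicative class of
  index \<open>s\<close>.\<close>

inductive Sigma0 :: "nat rel \<Rightarrow> 'a::topological_space set \<Rightarrow> bool" where
  Sigma0_open: "Well_order r \<Longrightarrow> card (Field r) = 1 \<Longrightarrow> open A \<Longrightarrow> Sigma0 r A"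
| Sigma0_Union: "Well_order r \<Longrightarrow>
    (\<And>n::nat. \<exists>s. s <o r \<and> Field s \<noteq> {} \<and> Sigma0 s (- A n)) \<Longrightarrow> Sigma0 r (\<Union>n. A n)"

definition Pi0 :: "nat rel \<Rightarrow> 'a::topological_space set \<Rightarrow> bool" where
  "Pi0 r A \<longleftrightarrow> Sigma0 r (- A)"

definition Delta0 :: "nat rel \<Rightarrow> 'a::topological_space set set" where
  "Delta0 r = {A. Sigma0 r A \<and> Pi0 r A}"

definition coloring :: "('a \<times> 'a) set \<Rightarrow> ('a \<Rightarrow> 'k) \<Rightarrow> bool" where
  "coloring B c \<longleftrightarrow> (\<forall>(x, y) \<in> B. c x \<noteq> c y)"

definition meas_coloring :: "'a set set \<Rightarrow> ('a \<times> 'a) set \<Rightarrow> ('a \<Rightarrow> 'k) \<Rightarrow> bool" where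
  "meas_coloring \<Gamma> B c \<longleftrightarrow> coloring B c \<and> (\<forall>k. c -` {k} \<in> \<Gamma>)"

definition has_finite_coloring :: "'a set set \<Rightarrow> ('a \<times> 'a) set \<Rightarrow> bool" where
  "has_finite_coloring \<Gamma> B \<longleftrightarrow>
    (\<exists>(n::nat) (c :: 'a \<Rightarrow> nat). range c \<subseteq> {0..<n} \<and> meas_coloring \<Gamma> B c)"

text \<open>The cardinal \<open>\<kappa>\<close> is the least cardinality of the range of a \<open>\<Gamma>\<close>-measurable coloring of \<open>B\<close>
  with countable range; in particular such a coloring exists. As only countable ranges
  matter, colors are taken in \<^typ>\<open>nat\<close>.\<close>

definition has_chromatic_number :: "'a set set \<Rightarrow> ('a \<times> 'a) set \<Rightarrow> 'c rel \<Rightarrow> bool" where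
  "has_chromatic_number \<Gamma> B \<kappa> \<longleftrightarrow>
    (\<exists>c :: 'a \<Rightarrow> nat. meas_coloring \<Gamma> B c \<and> |range c| =o \<kappa>) \<and>
    (\<forall>c :: 'a \<Rightarrow> nat. meas_coloring \<Gamma> B c \<longrightarrow> \<kappa> \<le>o |range c| )"

lemma Sigma0_one_iff:
  assumes "Well_order r" "card (Field r) = 1"
  shows "Sigma0 r A \<longleftrightarrow> open A"
proof
  assume "Sigma0 r A"
  then show "open A"
  proof cases
    case (Sigma0_Union B)
    from Sigma0_Union(3)[of 0] obtain s :: "nat rel" where s: "s <o r" "Field s \<noteq> {}" by blast
    from assms(2) obtain a where a: "Field r = {a}" by (auto simp: card_1_singleton_iff)
    from s(1) obtain g where g: "embedS s r g"
      unfolding ordLess_def by auto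
    then have "embed s r g" "\<not> bij_betw g (Field s) (Field r)"
      by (auto simp: embedS_def)
    moreover have "Well_order s" using s(1) by (auto simp: ordLess_def)
    ultimately have "inj_on g (Field s)" "g ` Field s \<subseteq> Field r"
      using assms(1) by (auto simp: embed_inj_on dest: embed_Field)
    with s(2) a have "g ` Field s = Field r" by auto
    then have "bij_betw g (Field s) (Field r)"
      using \<open>inj_on g (Field s)\<close> by (auto simp: bij_betw_def)
    with \<open>\<not> bij_betw g (Field s) (Field r)\<close> show ?thesis by blast
  qed auto
qed (use assms in \<open>auto intro: Sigma0_open\<close>)

lemma Sigma0_gt_one_iff:
  assumes "Well_order r" "card (Field r) \<noteq> 1"
  shows "Sigma0 r A \<longleftrightarrow>
    (\<exists>B :: nat \<Rightarrow> _. A = (\<Union>n. B n) \<and> (\<forall>n. \<exists>s. s <o r \<and> Field s \<noteq> {} \<and> Pi0 s (B n)))"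
  using assms by (subst Sigma0.simps) (auto simp: Pi0_def)

end

(*
  Points of Baire space are pairs <a,b>. The parameter a codes a coloring c of class Delta^0_xi through
  a Borel universal set for the additive class, and f has at most one edge <a,b> -> <a,d> for each a, so
  that injectivity and disjointness of domain and range are automatic. For fixed a the colour of <a,b>
  is, for generic b, decided by a finite initial segment of b, with forcing data Borel in a; as c has
  finitely many colours, pigeonhole gives segments u and v that force the same colour, and any two
  generic extensions b of u and d of v are an edge with equal colours.

  For the graph to be closed, the pair (b,d) must carry a witness for all that was used about a. Every
  Borel map g has a companion h such that the graph of (g,h) is closed. The generics b and d are built
  in alternation; the letters of each code the stages of the other together with the values of g(a)
  and h(a), so that convergence of (a,b,d) forces convergence of (g(a),h(a)), hence of the whole
  construction.
*)
theory Submission imports Defs begin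

section \<open>Cylinders and convergence in Baire space\<close>

definition init :: "(nat \<Rightarrow> 'a) \<Rightarrow> nat \<Rightarrow> 'a list" where
  "init x n = map x [0..<n]"

definition cyl :: "'a list \<Rightarrow> (nat \<Rightarrow> 'a) set" where
  "cyl u = {x. init x (length u) = u}"

definition pr :: "(nat \<Rightarrow> 'a) \<Rightarrow> (nat \<Rightarrow> 'a) \<Rightarrow> nat \<Rightarrow> 'a" where
  "pr a b = (\<lambda>n. if even n then a (n div 2) else b (n div 2))"

definition prl :: "(nat \<Rightarrow> 'a) \<Rightarrow> nat \<Rightarrow> 'a" where
  "prl x = (\<lambda>n. x (2 * n))"

definition prr :: "(nat \<Rightarrow> 'a) \<Rightarrow> nat \<Rightarrow> 'a" where
  "prr x = (\<lambda>n. x (2 * n + 1))"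

text \<open>Column \<open>slice a k\<close> of a parameter will code the class of colour
  \<open>k\<close>, so that a single point codes a whole colouring.\<close>

definition slice :: "(nat \<Rightarrow> 'a) \<Rightarrow> nat \<Rightarrow> nat \<Rightarrow> 'a" where
  "slice a i = (\<lambda>n. a (prod_encode (i, n)))"

definition unslices :: "(nat \<Rightarrow> nat \<Rightarrow> 'a) \<Rightarrow> nat \<Rightarrow> 'a" where
  "unslices f = (\<lambda>m. case prod_decode m of (i, n) \<Rightarrow> f i n)"

lemma slice_unslices [simp]: "slice (unslices f) i = f i"
  by (simp add: slice_def unslices_def)

lemma prl_pr [simp]: "prl (pr a b) = a" and prr_pr [simp]: "prr (pr a b) = b"
  by (auto simp: prl_def prr_def pr_def)

lemma pr_inject [simp]: "pr a b = pr a' b' \<longleftrightarrow> a = a' \<and> b = b'"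
  by (metis prl_pr prr_pr)

lemma length_init [simp]: "length (init x n) = n"
  by (simp add: init_def)

lemma init_nth [simp]: "i < n \<Longrightarrow> init x n ! i = x i"
  by (simp add: init_def)

lemma take_init [simp]: "take m (init x n) = init x (min m n)"
  by (simp add: init_def take_map take_upt min_def)

lemma init_mono: "m \<le> n \<Longrightarrow> \<exists>w. init x n = init x m @ w"
  by (metis append_take_drop_id min_def take_init)

lemma cyl_iff: "x \<in> cyl u \<longleftrightarrow> (\<forall>i<length u. x i = u ! i)"
  by (auto simp: cyl_def list_eq_iff_nth_eq)

lemma cyl_Nil [simp]: "cyl [] = UNIV"
  by (auto simp: cyl_iff)

lemma mem_cyl_init [simp]: "x \<in> cyl (init x n)"
  by (simp add: cyl_def)

section \<open>Coordinatewise convergence and cylinders as a clopen base\<close>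

lemma tendsto_fun_iff:
  fixes X :: "'a \<Rightarrow> 'i \<Rightarrow> 'b::topological_space"
  shows "(X \<longlongrightarrow> x) F \<longleftrightarrow> (\<forall>i. ((\<lambda>k. X k i) \<longlongrightarrow> x i) F)"
  using limitin_componentwise[of "\<lambda>_. euclidean" UNIV X x F]
  by (simp add: euclidean_product_topology)

lemma tendsto_baire_iff:
  fixes X :: "'a \<Rightarrow> baire"
  shows "(X \<longlongrightarrow> x) F \<longleftrightarrow> (\<forall>i. \<forall>\<^sub>F k in F. X k i = x i)"
  by (simp add: tendsto_fun_iff tendsto_discrete)

lemma baire_limit_unique:
  fixes X :: "nat \<Rightarrow> baire"
  assumes "X \<longlonglongrightarrow> y" "X \<longlonglongrightarrow> z"
  shows "y = z"
proof
  fix i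
  have "\<forall>\<^sub>F k in sequentially. X k i = y i" "\<forall>\<^sub>F k in sequentially. X k i = z i"
    using assms by (simp_all add: tendsto_baire_iff)
  from eventually_happens'[OF sequentially_bot eventually_conj[OF this]] show "y i = z i" by auto
qed

lemma init_tendsto:
  fixes x :: baire
  assumes "\<And>n. X n \<in> cyl (init x n)"
  shows "X \<longlonglongrightarrow> x"
  unfolding tendsto_baire_iff
proof
  fix i
  show "\<forall>\<^sub>F k in sequentially. X k i = x i"
    using eventually_gt_at_top[of i] by eventually_elim (use assms in \<open>auto simp: cyl_iff\<close>)
qed

text \<open>Points outside \<open>U\<close> chosen in ever longer cylinders around \<open>x\<close>
  would converge to \<open>x\<close>, against openness.\<close>

lemma open_contains_cyl:
  fixes x :: baire
  assumes "open U" "x \<in> U"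
  shows "\<exists>n. cyl (init x n) \<subseteq> U"
proof (rule ccontr)
  assume "\<not> ?thesis"
  then obtain X where X: "\<And>n. X n \<in> cyl (init x n)" "\<And>n. X n \<notin> U"
    unfolding subset_iff by metis
  have "X \<longlonglongrightarrow> x" by (rule init_tendsto) (rule X)
  then have "\<forall>\<^sub>F n in sequentially. X n \<in> U"
    using assms by (rule topological_tendstoD)
  with X(2) show False by simp
qed

lemma open_coord_vimage: "open {x :: 'i \<Rightarrow> nat. P (x i)}"
  using open_vimage[OF open_discrete continuous_on_product_coordinates[where i=i], of "{n. P n}"]
  by (simp add: vimage_def)

lemma open_cyl: "open (cyl u :: baire set)"
proof -
  have "cyl u = (\<Inter>i\<in>{..<length u}. {x :: baire. x i = u ! i})" by (auto simp: cyl_iff)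
  then show ?thesis by (auto intro!: open_INT open_coord_vimage)
qed

lemma open_prod_contains_cyl:
  fixes a b :: baire
  assumes "open Z" "(a, b) \<in> Z"
  shows "\<exists>n m. cyl (init a n) \<times> cyl (init b m) \<subseteq> Z"
proof -
  obtain U V where UV: "open U" "open V" "(a, b) \<in> U \<times> V" "U \<times> V \<subseteq> Z"
    using assms open_prod_elim by metis
  obtain n m where "cyl (init a n) \<subseteq> U" "cyl (init b m) \<subseteq> V"
    using UV open_contains_cyl by (metis SigmaE2)
  with UV(4) show ?thesis by blast
qed

lemma continuous_on_slice [continuous_intros]:
  fixes f :: "'a::topological_space \<Rightarrow> nat \<Rightarrow> 'b::topological_space"
  assumes "continuous_on S f"
  shows "continuous_on S (\<lambda>x. slice (f x) i)"
  unfolding slice_def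
  by (rule continuous_on_coordinatewise_then_product)
    (rule continuous_on_product_then_coordinatewise[OF assms])

lemma continuous_on_prl [continuous_intros]:
  fixes f :: "'a::topological_space \<Rightarrow> nat \<Rightarrow> 'b::topological_space"
  assumes "continuous_on S f"
  shows "continuous_on S (\<lambda>x. prl (f x))"
  unfolding prl_def
  by (rule continuous_on_coordinatewise_then_product)
    (rule continuous_on_product_then_coordinatewise[OF assms])

lemma continuous_on_prr [continuous_intros]:
  fixes f :: "'a::topological_space \<Rightarrow> nat \<Rightarrow> 'b::topological_space"
  assumes "continuous_on S f"
  shows "continuous_on S (\<lambda>x. prr (f x))"
  unfolding prr_def
  by (rule continuous_on_coordinatewise_then_product)
    (rule continuous_on_product_then_coordinatewise[OF assms])

lemma continuous_on_pr [continuous_intros]: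
  fixes f g :: "'a::topological_space \<Rightarrow> nat \<Rightarrow> 'b::topological_space"
  assumes "continuous_on S f" "continuous_on S g"
  shows "continuous_on S (\<lambda>x. pr (f x) (g x))"
  unfolding pr_def
proof (rule continuous_on_coordinatewise_then_product)
  fix i
  show "continuous_on S (\<lambda>x. if even i then f x (i div 2) else g x (i div 2))"
    using assms[THEN continuous_on_product_then_coordinatewise] by (cases "even i") auto
qed

section \<open>Borel sets defined by connectives and countable quantifiers\<close>

lemma borel_Ex:
  fixes P :: "'i::countable \<Rightarrow> 'a::topological_space \<Rightarrow> bool"
  assumes "\<And>i. {x. P i x} \<in> sets borel"
  shows "{x. \<exists>i. P i x} \<in> sets borel"
  using sets.sets_Collect_countable_Ex[of borel P] assms by simp

lemma borel_All:
  fixes P :: "'i::countable \<Rightarrow> 'a::topological_space \<Rightarrow> bool"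
  assumes "\<And>i. {x. P i x} \<in> sets borel"
  shows "{x. \<forall>i. P i x} \<in> sets borel"
  using sets.sets_Collect_countable_All[of borel P] assms by simp

lemma borel_Conj: "{x. P x} \<in> sets borel \<Longrightarrow> {x. Q x} \<in> sets borel \<Longrightarrow> {x. P x \<and> Q x} \<in> sets borel"
  using sets.sets_Collect_conj[of borel Q P] by simp

lemma borel_Imp: "{x. P x} \<in> sets borel \<Longrightarrow> {x. Q x} \<in> sets borel \<Longrightarrow> {x. P x \<longrightarrow> Q x} \<in> sets borel"
  using sets.sets_Collect_imp[of borel Q P] by simp

lemma borel_Not: "{x. P x} \<in> sets borel \<Longrightarrow> {x. \<not> P x} \<in> sets borel"
  using sets.sets_Collect_neg[of borel P] by simp

lemma borel_const: "{x. P} \<in> sets borel"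
  using sets.sets_Collect_const[of borel P] by simp

lemma borel_continuous_vimage:
  assumes "continuous_on UNIV f" "U \<in> sets borel"
  shows "{x. f x \<in> U} \<in> sets borel"
  using measurable_sets_borel[OF borel_measurable_continuous_onI[OF assms(1)] assms(2)]
  by (simp add: vimage_def)

section \<open>Borel universal sets for the additive classes\<close>

text \<open>A Borel set that has every member of \<open>C\<close> among its sections. Further
  sections are allowed, so it is enough to bound a class from above.\<close>

definition parametrizable :: "baire set set \<Rightarrow> bool" where
  "parametrizable C \<longleftrightarrow>
    (\<exists>U \<in> sets (borel :: (baire \<times> baire) measure). \<forall>A \<in> C. \<exists>a. A = {x. (a, x) \<in> U})"

lemma parametrizable_subset: "parametrizable D \<Longrightarrow> C \<subseteq> D \<Longrightarrow> parametrizable C"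
  unfolding parametrizable_def by blast

lemma parametrizable_open: "parametrizable {A. open A}"
proof -
  let ?U = "{p :: baire \<times> baire. \<exists>u. fst p (to_nat u) = 1 \<and> snd p \<in> cyl u}"
  have "?U = (\<Union>u. {a. a (to_nat u) = 1} \<times> cyl u)" by auto
  then have "open ?U"
    by (auto intro!: open_UN open_Times open_cyl open_coord_vimage)
  then have "?U \<in> sets borel" by simp
  moreover have "\<exists>a. A = {x. (a, x) \<in> ?U}" if "open A" for A
  proof -
    \<comment> \<open>The parameter is the characteristic sequence of the words whose cylinders lie
      inside \<open>A\<close>.\<close>
    let ?a = "\<lambda>n. if cyl (from_nat n) \<subseteq> A then 1 else 0 :: nat"
    have "x \<in> A \<longleftrightarrow> (\<exists>u. cyl u \<subseteq> A \<and> x \<in> cyl u)" for x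
      using open_contains_cyl[OF that, of x] mem_cyl_init[of x] by blast
    then have "A = {x. \<exists>u. cyl u \<subseteq> A \<and> x \<in> cyl u}" by blast
    also have "\<dots> = {x. (?a, x) \<in> ?U}" by auto
    finally have "A = {x. (?a, x) \<in> ?U}" .
    then show ?thesis by blast
  qed
  ultimately show ?thesis unfolding parametrizable_def by blast
qed

text \<open>The first letter of the left half of a parameter names one of the classes, and the right
  half is a parameter for that class.\<close>

lemma parametrizable_UN:
  fixes C :: "nat \<Rightarrow> baire set set"
  assumes "\<And>i. parametrizable (C i)"
  shows "parametrizable (\<Union>i. C i)"
proof -
  have "\<forall>i. \<exists>U. U \<in> sets (borel :: (baire \<times> baire) measure) \<and> (\<forall>A\<in>C i. \<exists>a. A = {x. (a, x) \<in> U})"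
    using assms unfolding parametrizable_def by blast
  from choice[OF this] obtain U :: "nat \<Rightarrow> (baire \<times> baire) set"
    where U: "\<And>i. U i \<in> sets borel" "\<And>i A. A \<in> C i \<Longrightarrow> \<exists>a. A = {x. (a, x) \<in> U i}"
    by blast
  let ?U = "{p :: baire \<times> baire. \<exists>i. prl (fst p) 0 = i \<and> (prr (fst p), snd p) \<in> U i}"
  have "?U \<in> sets borel"
  proof (intro borel_Ex borel_Conj)
    fix i
    have "open {p :: baire \<times> baire. prl (fst p) 0 = i}"
    proof -
      have "{p :: baire \<times> baire. prl (fst p) 0 = i} = {a. a 0 = i} \<times> UNIV"
        by (auto simp: prl_def)
      then show ?thesis by (auto intro!: open_Times open_coord_vimage)
    qed
    then show "{p :: baire \<times> baire. prl (fst p) 0 = i} \<in> sets borel" by simp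
    show "{p :: baire \<times> baire. (prr (fst p), snd p) \<in> U i} \<in> sets borel"
      by (intro borel_continuous_vimage[OF _ U(1)] continuous_intros continuous_on_id)
  qed
  moreover have "\<exists>a. A = {x. (a, x) \<in> ?U}" if "A \<in> C i" for A i
  proof -
    from U(2)[OF that] obtain a where "A = {x. (a, x) \<in> U i}" by blast
    then have "A = {x. (pr (\<lambda>_. i) a, x) \<in> ?U}" by simp
    then show ?thesis by blast
  qed
  ultimately show ?thesis unfolding parametrizable_def by blast
qed

text \<open>Column \<open>n\<close> of the new parameter codes \<open>B n\<close>; a countable union
  of complements of Borel conditions stays Borel.\<close>

lemma parametrizable_Union_Compl:
  assumes "parametrizable C"
  shows "parametrizable {\<Union>n::nat. - B n | B. \<forall>n. B n \<in> C}"
proof -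
  obtain U :: "(baire \<times> baire) set" where U: "U \<in> sets borel" "\<And>A. A \<in> C \<Longrightarrow> \<exists>a. A = {x. (a, x) \<in> U}"
    using assms unfolding parametrizable_def by metis
  let ?U = "{p :: baire \<times> baire. \<exists>n. \<not> (slice (fst p) n, snd p) \<in> U}"
  have "?U \<in> sets borel"
    by (intro borel_Ex borel_Not borel_continuous_vimage[OF _ U(1)] continuous_intros continuous_on_id)
  moreover have "\<exists>a. A = {x. (a, x) \<in> ?U}" if "A = (\<Union>n::nat. - B n)" "\<forall>n. B n \<in> C" for A B
  proof -
    have "\<forall>n. \<exists>a. B n = {x. (a, x) \<in> U}" using U(2) that(2) by blast
    then obtain a where "\<And>n. B n = {x. (a n, x) \<in> U}" by metis
    then have "A = {x. (unslices a, x) \<in> ?U}" using that(1) by auto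
    then show ?thesis by blast
  qed
  ultimately show ?thesis unfolding parametrizable_def by blast
qed

text \<open>Allows a lower level to be replaced by the initial segment of a fixed well-order to
  which it is isomorphic.\<close>

lemma Sigma0_ordIso:
  fixes r s :: "nat rel"
  assumes "Sigma0 r A" "r =o s"
  shows "Sigma0 s A"
  using assms(1)
proof cases
  case Sigma0_open
  obtain f where "iso r s f" using assms(2) by (auto simp: ordIso_def)
  then have "card (Field s) = 1" using Sigma0_open(2) bij_betw_same_card by (metis iso_def)
  moreover have "Well_order s" using assms(2) by (auto simp: ordIso_def)
  ultimately show ?thesis using Sigma0_open by (intro Sigma0.Sigma0_open)
next
  case (Sigma0_Union B)
  have "Well_order s" using assms(2) by (auto simp: ordIso_def)
  then show ?thesis unfolding Sigma0_Union(1)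
    using Sigma0_Union(3) ordLess_ordIso_trans[OF _ assms(2)]
    by (intro Sigma0.Sigma0_Union) blast+
qed

lemma parametrizable_Sigma0: "parametrizable {A. Sigma0 r A}"
proof (induction r rule: wf_induct_rule[OF wf_ordLess])
  case (1 r)
  show ?case
  proof (cases "Well_order r")
    case False
    then have "{A :: baire set. Sigma0 r A} = {}" by (auto elim: Sigma0.cases)
    then show ?thesis using parametrizable_subset[OF parametrizable_open] by simp
  next
    case True
    \<comment> \<open>Every \<open>s <o r\<close> is isomorphic to a proper initial segment of
      \<open>r\<close>, and these are indexed by numbers, so countably many lower classes suffice.
      The test \<open>R a <o r\<close> in \<open>C\<close> makes the induction hypothesis available
      at every index.\<close>
    define R where "R a = Restr r (underS r a)" for a
    define C where "C a = (if R a <o r then {A :: baire set. Sigma0 (R a) A} else {})" for a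
    define D where "D = {\<Union>n::nat. - B n | B. \<forall>n. B n \<in> (\<Union>a. C a)}"
    have "parametrizable (C a)" for a
      using 1 parametrizable_subset[OF parametrizable_open] by (auto simp: C_def)
    then have D: "parametrizable D"
      unfolding D_def by (intro parametrizable_Union_Compl parametrizable_UN)
    \<comment> \<open>Index 0 catches the rule for open sets, every positive index the rule for
      unions.\<close>
    have "{A. Sigma0 r A} \<subseteq> (\<Union>i. case i of 0 \<Rightarrow> {A. open A} | Suc _ \<Rightarrow> D)"
    proof clarify
      fix A :: "baire set" assume "Sigma0 r A"
      then show "A \<in> (\<Union>i. case i of 0 \<Rightarrow> {A. open A} | Suc _ \<Rightarrow> D)"
      proof cases
        case Sigma0_open
        then show ?thesis by (auto intro!: exI[of _ 0])
      next
        case (Sigma0_Union B)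
        have "- B n \<in> (\<Union>a. C a)" for n
        proof -
          obtain s where s: "s <o r" "Sigma0 s (- B n)" using Sigma0_Union(3) by blast
          have "Well_order s" using s(1) by (auto simp: ordLess_def)
          then obtain a where a: "s =o R a"
            using s(1) ordLess_iff_ordIso_Restr[OF True] unfolding R_def by blast
          have "R a <o r" using a s(1) by (meson ordIso_ordLess_trans ordIso_symmetric)
          moreover have "Sigma0 (R a) (- B n)" by (rule Sigma0_ordIso[OF s(2) a])
          ultimately show ?thesis by (auto simp: C_def)
        qed
        then have "A \<in> D"
          unfolding D_def Sigma0_Union(1) by (intro CollectI exI[of _ "\<lambda>n. - B n"]) auto
        then show ?thesis by (auto intro!: exI[of _ "Suc 0"])
      qed
    qed
    moreover have "parametrizable (case i of 0 \<Rightarrow> {A. open A} | Suc _ \<Rightarrow> D)" for i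
      using D parametrizable_open by (auto split: nat.split)
    ultimately show ?thesis using parametrizable_UN parametrizable_subset by metis
  qed
qed

section \<open>Clopen sets belong to every class\<close>

lemma Sigma0_clopen:
  fixes A :: "'a::topological_space set"
  assumes "Well_order r" "Field r \<noteq> {}" "open A" "closed A"
  shows "Sigma0 r A"
proof (cases "card (Field r) = 1")
  case True
  then show ?thesis using assms by (intro Sigma0_open)
next
  case False
  obtain x where x: "x \<in> Field r" using assms(2) by blast
  \<comment> \<open>A well-order of type 1. Above this type \<open>A\<close> is the union of the
    constant sequence \<open>A\<close>, and \<open>- A\<close> is open, hence of level
    \<open>?s\<close>. Were \<open>?s\<close> not below \<open>r\<close>, then \<open>r\<close>
    would embed into one point.\<close>
  let ?s = "|{x}|"
  have s: "Well_order ?s" "Field ?s = {x}" "card (Field ?s) = 1"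
    by (simp_all add: card_of_well_order_on Field_card_of)
  have "\<not> r \<le>o ?s"
  proof
    assume "r \<le>o ?s"
    then obtain f where "embed r ?s f" by (auto simp: ordLeq_def)
    then have "inj_on f (Field r)" "f ` Field r \<subseteq> {x}"
      using assms(1) s(2) by (auto simp: embed_inj_on dest: embed_Field)
    then have "card (Field r) \<le> 1" "finite (Field r)"
      using card_inj_on_le[of f "Field r" "{x}"] inj_on_finite[of f "Field r" "{x}"] by auto
    with False assms(2) show False by (simp add: le_Suc_eq)
  qed
  then have "?s <o r" using assms(1) s(1) not_ordLeq_iff_ordLess by blast
  moreover have "Sigma0 ?s (- A)" using s assms(4) by (intro Sigma0_open) auto
  ultimately have "Sigma0 r (\<Union>n::nat. A)" using s(2)
    by (intro Sigma0_Union assms(1) exI[of _ ?s]) auto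
  then show ?thesis by simp
qed

lemma Delta0_clopen:
  "Well_order r \<Longrightarrow> Field r \<noteq> {} \<Longrightarrow> open A \<Longrightarrow> closed A \<Longrightarrow> A \<in> Delta0 r"
  by (simp add: Delta0_def Pi0_def Sigma0_clopen open_Compl closed_Compl)


section \<open>Closed graphs of expanded Borel maps\<close>

text \<open>Sequential closedness of the graph of the pair \<open>(g, h)\<close>. Adding
  \<open>h\<close> can close the graph of a discontinuous \<open>g\<close>, as it leaves fewer
  convergent sequences to consider.\<close>

definition refinable :: "(baire \<Rightarrow> baire) \<Rightarrow> bool" where
  "refinable g \<longleftrightarrow> (\<exists>h :: baire \<Rightarrow> baire. \<forall>X a y z.
     X \<longlonglongrightarrow> a \<longrightarrow> (\<lambda>k. g (X k)) \<longlonglongrightarrow> y \<longrightarrow> (\<lambda>k. h (X k)) \<longlonglongrightarrow> z \<longrightarrow> y = g a \<and> z = h a)"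

lemma tendsto_pr_iff:
  fixes Y Z :: "'a \<Rightarrow> baire"
  shows "((\<lambda>k. pr (Y k) (Z k)) \<longlongrightarrow> x) F \<longleftrightarrow> (Y \<longlongrightarrow> prl x) F \<and> (Z \<longlongrightarrow> prr x) F"
  (is "?L \<longleftrightarrow> ?R")
proof
  assume ?L
  then have *: "\<forall>\<^sub>F k in F. pr (Y k) (Z k) i = x i" for i by (simp add: tendsto_baire_iff)
  show ?R
    unfolding tendsto_baire_iff prl_def prr_def
    using *[of "2 * _"] *[of "2 * _ + 1"] by (simp add: pr_def)
next
  assume ?R
  then have *: "\<forall>\<^sub>F k in F. Y k i = x (2 * i)" "\<forall>\<^sub>F k in F. Z k i = x (2 * i + 1)" for i
    by (simp_all add: tendsto_baire_iff prl_def prr_def)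
  show ?L
    unfolding tendsto_baire_iff
  proof
    fix i
    show "\<forall>\<^sub>F k in F. pr (Y k) (Z k) i = x i"
      using *[of "i div 2"] by (cases "even i") (simp_all add: pr_def)
  qed
qed

lemma tendsto_unslices_iff:
  fixes Y :: "'a \<Rightarrow> nat \<Rightarrow> baire"
  shows "((\<lambda>k. unslices (Y k)) \<longlongrightarrow> x) F \<longleftrightarrow> (\<forall>i. ((\<lambda>k. Y k i) \<longlongrightarrow> slice x i) F)"
proof -
  have "(\<forall>m. P (fst (prod_decode m)) (snd (prod_decode m)) m) \<longleftrightarrow> (\<forall>i n. P i n (prod_encode (i, n)))"
    for P
    by (metis fst_conv prod_decode_inverse prod_encode_inverse snd_conv surj_pair)
  from this[of "\<lambda>i n m. \<forall>\<^sub>F k in F. Y k i n = x m"] show ?thesis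
    by (simp add: tendsto_baire_iff slice_def unslices_def case_prod_beta)
qed

lemma prl_prr_eqI: "prl x = a \<Longrightarrow> prr x = b \<Longrightarrow> x = pr a b"
proof
  fix n assume "prl x = a" "prr x = b"
  then show "x n = pr a b n"
    by (cases "even n") (auto simp: prl_def prr_def pr_def fun_eq_iff elim!: evenE oddE)
qed

lemma slice_eqI: "(\<And>i. slice x i = f i) \<Longrightarrow> x = unslices f"
proof
  fix n assume *: "\<And>i. slice x i = f i"
  obtain i m where n: "prod_decode n = (i, m)" by fastforce
  with *[of i] show "x n = unslices f n"
    unfolding slice_def unslices_def fun_eq_iff by (metis case_prod_conv prod_decode_inverse)
qed

lemma refinable_slices:
  assumes "\<And>i. refinable (g i)"
  shows "refinable (\<lambda>a. unslices (\<lambda>i. g i a))"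
proof -
  have "\<forall>i. \<exists>h :: baire \<Rightarrow> baire. \<forall>X a y z. X \<longlonglongrightarrow> a \<longrightarrow> (\<lambda>k. g i (X k)) \<longlonglongrightarrow> y \<longrightarrow>
      (\<lambda>k. h (X k)) \<longlonglongrightarrow> z \<longrightarrow> y = g i a \<and> z = h a"
    using assms unfolding refinable_def by blast
  from choice[OF this] obtain h :: "nat \<Rightarrow> baire \<Rightarrow> baire" where
    h: "\<And>i X a y z. X \<longlonglongrightarrow> a \<Longrightarrow> (\<lambda>k. g i (X k)) \<longlonglongrightarrow> y \<Longrightarrow> (\<lambda>k. h i (X k)) \<longlonglongrightarrow> z \<Longrightarrow>
      y = g i a \<and> z = h i a"
    by blast
  show ?thesis
    unfolding refinable_def
  proof (intro exI[of _ "\<lambda>a. unslices (\<lambda>i. h i a)"] allI impI)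
    fix X a y z
    assume X: "X \<longlonglongrightarrow> a" and "(\<lambda>k. unslices (\<lambda>i. g i (X k))) \<longlonglongrightarrow> y"
      and "(\<lambda>k. unslices (\<lambda>i. h i (X k))) \<longlonglongrightarrow> z"
    then have "(\<lambda>k. g i (X k)) \<longlonglongrightarrow> slice y i" "(\<lambda>k. h i (X k)) \<longlonglongrightarrow> slice z i" for i
      by (simp_all add: tendsto_unslices_iff)
    from h[OF X this] show "y = unslices (\<lambda>i. g i a) \<and> z = unslices (\<lambda>i. h i a)"
      by (auto intro: slice_eqI)
  qed
qed

text \<open>The companion of \<open>f\<close> is \<open>g\<close> paired with the companion of
  \<open>g\<close>. If it converges along \<open>X\<close>, then \<open>g\<close> converges to its
  value at the limit, and only such sequences need be tested for \<open>f\<close>.\<close>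

lemma refinable_from:
  assumes g: "refinable g"
    and *: "\<And>X a y. X \<longlonglongrightarrow> a \<Longrightarrow> (\<lambda>k. f (X k)) \<longlonglongrightarrow> y \<Longrightarrow> (\<lambda>k. g (X k)) \<longlonglongrightarrow> g a \<Longrightarrow> y = f a"
  shows "refinable f"
proof -
  obtain h :: "baire \<Rightarrow> baire" where
    h: "\<And>X a y z. X \<longlonglongrightarrow> a \<Longrightarrow> (\<lambda>k. g (X k)) \<longlonglongrightarrow> y \<Longrightarrow> (\<lambda>k. h (X k)) \<longlonglongrightarrow> z \<Longrightarrow> y = g a \<and> z = h a"
    using g unfolding refinable_def by blast
  show ?thesis
    unfolding refinable_def
  proof (intro exI[of _ "\<lambda>a. pr (g a) (h a)"] allI impI)
    fix X a y z
    assume X: "X \<longlonglongrightarrow> a" and y: "(\<lambda>k. f (X k)) \<longlonglongrightarrow> y" and "(\<lambda>k. pr (g (X k)) (h (X k))) \<longlonglongrightarrow> z"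
    then have z: "(\<lambda>k. g (X k)) \<longlonglongrightarrow> prl z" "(\<lambda>k. h (X k)) \<longlonglongrightarrow> prr z"
      by (auto simp: tendsto_pr_iff)
    with h[OF X] have "prl z = g a" "prr z = h a" by auto
    then show "y = f a \<and> z = pr (g a) (h a)"
      using *[OF X y] z by (auto intro: prl_prr_eqI)
  qed
qed

text \<open>The truth value is spread over a constant sequence to give a map into Baire
  space.\<close>

definition indic :: "baire set \<Rightarrow> baire \<Rightarrow> baire" where
  "indic B a = (\<lambda>_. if a \<in> B then 1 else 0)"

lemma tendsto_indic_iff:
  fixes X :: "'a \<Rightarrow> baire"
  shows "((\<lambda>k. indic B (X k)) \<longlongrightarrow> indic B a) F \<longleftrightarrow> (\<forall>\<^sub>F k in F. X k \<in> B \<longleftrightarrow> a \<in> B)"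
  by (simp add: tendsto_baire_iff indic_def)

text \<open>Recording the least witness \<open>n\<close> makes the limit of \<open>first_index\<close> decide membership in the
  union, which the limit of the indicators of the \<open>B n\<close> alone does not.\<close>

definition first_index :: "(nat \<Rightarrow> 'a set) \<Rightarrow> 'a \<Rightarrow> baire" where
  "first_index B a = (\<lambda>_. if \<exists>n. a \<in> B n then Suc (LEAST n. a \<in> B n) else 0)"

lemma refinable_first_index:
  assumes "\<And>n. refinable (indic (B n))"
  shows "refinable (first_index B)"
proof (rule refinable_from[OF refinable_slices[OF assms]])
  fix X :: "nat \<Rightarrow> baire" and a y
  assume y: "(\<lambda>k. first_index B (X k)) \<longlonglongrightarrow> y"
    and "(\<lambda>k. unslices (\<lambda>i. indic (B i) (X k))) \<longlonglongrightarrow> unslices (\<lambda>i. indic (B i) a)"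
  then have ind: "\<forall>\<^sub>F k in sequentially. X k \<in> B n \<longleftrightarrow> a \<in> B n" for n
    by (simp add: tendsto_unslices_iff tendsto_indic_iff)
  have fi: "\<forall>\<^sub>F k in sequentially. first_index B (X k) i = y i" for i
    using y by (simp add: tendsto_baire_iff)
  show "y = first_index B a"
  proof
    fix i
    show "y i = first_index B a i"
    proof (cases "y i")
      case 0
      \<comment> \<open>A limit value 0 means that \<open>X k\<close> eventually lies in no
        \<open>B n\<close>, whereas membership in each single \<open>B n\<close> eventually agrees
        with that of \<open>a\<close>.\<close>
      have "a \<notin> B n" for n
      proof
        assume "a \<in> B n"
        obtain k where "X k \<in> B n \<longleftrightarrow> a \<in> B n" "first_index B (X k) i = y i"
          using eventually_happens'[OF sequentially_bot eventually_conj[OF ind[of n] fi[of i]]] by blast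
        with \<open>a \<in> B n\<close> show False by (auto simp: first_index_def 0 split: if_splits)
      qed
      then show ?thesis by (simp add: first_index_def 0)
    next
      case (Suc n)
      \<comment> \<open>Only the finitely many sets up to the least witness \<open>n\<close> matter,
        so their indicators settle together and minimality passes to \<open>a\<close>.\<close>
      have "\<forall>\<^sub>F k in sequentially. \<forall>m\<in>{..n}. X k \<in> B m \<longleftrightarrow> a \<in> B m"
        using ind by (intro eventually_ball_finite) auto
      with fi[of i] have "\<forall>\<^sub>F k in sequentially. a \<in> B n \<and> (\<forall>m<n. a \<notin> B m)"
      proof eventually_elim
        case (elim k)
        then have ex: "\<exists>n. X k \<in> B n" and n: "n = (LEAST n. X k \<in> B n)"
          by (auto simp: first_index_def Suc split: if_splits)
        have "X k \<in> B n" unfolding n by (rule LeastI_ex[OF ex])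
        moreover have "X k \<notin> B m" if "m < n" for m
          using that unfolding n by (rule not_less_Least)
        ultimately show ?case using elim by auto
      qed
      then have *: "a \<in> B n" "\<And>m. m < n \<Longrightarrow> a \<notin> B m" by auto
      then have "(LEAST n. a \<in> B n) = n" by (intro Least_equality) (auto simp: not_less[symmetric])
      then show ?thesis using *(1) by (auto simp: first_index_def Suc)
    qed
  qed
qed

lemma refinable_indic_UN:
  assumes "\<And>n::nat. refinable (indic (B n))"
  shows "refinable (indic (\<Union>n. B n))"
proof -
  show ?thesis
  proof (rule refinable_from[OF refinable_first_index[OF assms]])
    fix X :: "nat \<Rightarrow> baire" and a y
    assume y: "(\<lambda>k. indic (\<Union>n. B n) (X k)) \<longlonglongrightarrow> y"
      and "(\<lambda>k. first_index B (X k)) \<longlonglongrightarrow> first_index B a"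
    then have "\<forall>\<^sub>F k in sequentially. first_index B (X k) 0 = first_index B a 0"
      by (simp add: tendsto_baire_iff)
    then have "\<forall>\<^sub>F k in sequentially. X k \<in> (\<Union>n. B n) \<longleftrightarrow> a \<in> (\<Union>n. B n)"
      by eventually_elim (auto simp: first_index_def split: if_splits)
    then have "(\<lambda>k. indic (\<Union>n. B n) (X k)) \<longlonglongrightarrow> indic (\<Union>n. B n) a"
      by (simp add: tendsto_indic_iff)
    with y show "y = indic (\<Union>n. B n) a" by (rule baire_limit_unique)
  qed
qed

lemma refinable_indic_Compl:
  assumes "refinable (indic B)"
  shows "refinable (indic (- B))"
proof (rule refinable_from[OF assms])
  fix X :: "nat \<Rightarrow> baire" and a y
  assume y: "(\<lambda>k. indic (- B) (X k)) \<longlonglongrightarrow> y" and "(\<lambda>k. indic B (X k)) \<longlonglongrightarrow> indic B a"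
  then have "(\<lambda>k. indic (- B) (X k)) \<longlonglongrightarrow> indic (- B) a" by (simp add: tendsto_indic_iff)
  with y show "y = indic (- B) a" by (rule baire_limit_unique)
qed

lemma refinable_indic_cyl: "refinable (indic (cyl u))"
proof -
  have "\<forall>\<^sub>F k in sequentially. X k \<in> cyl u \<longleftrightarrow> a \<in> cyl u"
    if "X \<longlonglongrightarrow> a" for X :: "nat \<Rightarrow> baire" and a
  proof -
    have "\<forall>\<^sub>F k in sequentially. \<forall>i\<in>{..<length u}. X k i = a i"
      using that by (intro eventually_ball_finite) (auto simp: tendsto_baire_iff)
    then show ?thesis by eventually_elim (auto simp: cyl_iff)
  qed
  then have "y = indic (cyl u) a"
    if "X \<longlonglongrightarrow> a" "(\<lambda>k. indic (cyl u) (X k)) \<longlonglongrightarrow> y" for X :: "nat \<Rightarrow> baire" and a y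
    using that baire_limit_unique tendsto_indic_iff by metis
  \<comment> \<open>The indicator of a cylinder is continuous, so a constant companion will
    do.\<close>
  then show ?thesis
    unfolding refinable_def by (intro exI[of _ "\<lambda>_ _. 0"]) (auto simp: tendsto_baire_iff)
qed

lemma refinable_indic_borel:
  assumes "B \<in> sets borel"
  shows "refinable (indic B)"
proof -
  have "B \<in> sigma_sets UNIV {S. open S}" using assms by (simp add: borel_def)
  then show ?thesis
  proof induction
    case (Basic U)
    then have "open U" by simp
    \<comment> \<open>Words that do not fit contribute the empty set, written
      \<open>- cyl []\<close> so that the complement lemma covers it.\<close>
    have U: "U = (\<Union>n::nat. if cyl (from_nat n) \<subseteq> U then cyl (from_nat n) else - cyl [])"
    proof (intro set_eqI iffI)
      fix x assume "x \<in> U"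
      then obtain n where "cyl (init x n) \<subseteq> U" using open_contains_cyl \<open>open U\<close> by blast
      then show "x \<in> (\<Union>n::nat. if cyl (from_nat n) \<subseteq> U then cyl (from_nat n) else - cyl [])"
        by (intro UN_I[of "to_nat (init x n)"]) auto
    qed (auto split: if_splits)
    show ?case
      using refinable_indic_cyl refinable_indic_Compl[OF refinable_indic_cyl[of "[]"]]
      by (subst U, intro refinable_indic_UN) auto
  next
    case Empty
    then show ?case
      using refinable_indic_Compl[OF refinable_indic_cyl[of "[]"]] by simp
  next
    case (Compl B)
    then show ?case by (simp add: refinable_indic_Compl Compl_eq_Diff_UNIV[symmetric])
  next
    case (Union B)
    then show ?case by (intro refinable_indic_UN)
  qed
qed

section \<open>A uniform Baire property\<close>

text \<open>Cohen forcing over each \<open>a\<close>: \<open>a \<in> P u\<close> says that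
  \<open>u\<close> forces membership in the section of \<open>Z\<close> at \<open>a\<close>, and the
  \<open>D n\<close> are dense requirements. For \<open>b\<close> meeting them all, membership is
  forced by an initial segment exactly when it holds.\<close>

definition uniform_bp :: "(baire \<times> baire) set \<Rightarrow> (nat list \<Rightarrow> baire set) \<Rightarrow> (nat \<Rightarrow> nat list \<Rightarrow> baire set) \<Rightarrow> bool" where
  "uniform_bp Z P D \<longleftrightarrow>
    (\<forall>u. P u \<in> sets borel) \<and> (\<forall>u w. P u \<subseteq> P (u @ w)) \<and>
    (\<forall>n u. D n u \<in> sets borel) \<and> (\<forall>a n u. \<exists>w. a \<in> D n (u @ w)) \<and>
    (\<forall>a b. (\<forall>n. \<exists>m. a \<in> D n (init b m)) \<longrightarrow> ((a, b) \<in> Z \<longleftrightarrow> (\<exists>m. a \<in> P (init b m))))"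

text \<open>For open \<open>Z\<close> every \<open>b\<close> counts as generic, and a word forces
  when some rectangle over its cylinder lies in \<open>Z\<close>.\<close>

lemma uniform_bp_open:
  assumes "open Z"
  shows "\<exists>P D. uniform_bp Z P D"
proof (intro exI)
  let ?P = "\<lambda>u. {a. \<exists>v. cyl v \<times> cyl u \<subseteq> Z \<and> a \<in> cyl v}"
  have "cyl (u @ w) \<subseteq> cyl u" for u w :: "nat list" by (auto simp: cyl_iff nth_append)
  then have mono: "?P u \<subseteq> ?P (u @ w)" for u w by blast
  have "(a, b) \<in> Z \<longleftrightarrow> (\<exists>m. a \<in> ?P (init b m))" for a b
  proof
    assume "(a, b) \<in> Z"
    with open_prod_contains_cyl[OF assms] obtain n m where "cyl (init a n) \<times> cyl (init b m) \<subseteq> Z"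
      by blast
    then show "\<exists>m. a \<in> ?P (init b m)" using mem_cyl_init by blast
  qed (use mem_cyl_init in blast)
  moreover have "?P u \<in> sets borel" for u
    by (intro borel_Ex borel_Conj borel_const) (simp add: open_cyl)
  ultimately show "uniform_bp Z ?P (\<lambda>_ _. UNIV)"
    unfolding uniform_bp_def using mono by auto
qed

text \<open>A word forces the complement when no extension of it forces \<open>Z\<close>.
  Requirement 0 asks for a word that decides between the two; the old requirements move up by
  one.\<close>

lemma uniform_bp_Compl:
  assumes "uniform_bp Z P D"
  shows "\<exists>P D. uniform_bp (- Z) P D"
proof (intro exI)
  let ?P = "\<lambda>u. {a. \<forall>w. a \<notin> P (u @ w)}"
  let ?D = "\<lambda>n u. case n of 0 \<Rightarrow> P u \<union> ?P u | Suc n \<Rightarrow> D n u"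
  have P: "P u \<in> sets borel" "P u \<subseteq> P (u @ w)" for u w
    using assms by (auto simp: uniform_bp_def)
  have D: "D n u \<in> sets borel" "\<exists>w. a \<in> D n (u @ w)" for n u a
    using assms by (auto simp: uniform_bp_def)
  have Z: "(a, b) \<in> Z \<longleftrightarrow> (\<exists>m. a \<in> P (init b m))" if "\<And>n. \<exists>m. a \<in> D n (init b m)" for a b
    using assms that by (auto simp: uniform_bp_def)
  have P'_borel: "?P u \<in> sets borel" for u
    by (intro borel_All borel_Not) (simp add: P)
  have P'_mono: "?P u \<subseteq> ?P (u @ w)" for u w by auto
  have D'_borel: "?D n u \<in> sets borel" for n u
    using P'_borel P(1) D(1) by (auto split: nat.split)
  have D'_dense: "\<exists>w. a \<in> ?D n (u @ w)" for a n u
  proof (cases n)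
    case 0
    show ?thesis
    proof (cases "\<exists>w. a \<in> P (u @ w)")
      case False
      then show ?thesis using 0 by (auto intro: exI[of _ "[]"])
    qed (use 0 in auto)
  qed (use D(2) in auto)
  have "(a, b) \<in> - Z \<longleftrightarrow> (\<exists>m. a \<in> ?P (init b m))"
    if gen: "\<And>n. \<exists>m. a \<in> ?D n (init b m)" for a b
  proof -
    have "\<exists>m. a \<in> D n (init b m)" for n using gen[of "Suc n"] by simp
    then have Z': "(a, b) \<in> Z \<longleftrightarrow> (\<exists>m. a \<in> P (init b m))" by (rule Z)
    \<comment> \<open>Two initial segments of one \<open>b\<close> are comparable, so they cannot
      force opposite answers.\<close>
    have "\<not> (a \<in> P (init b m) \<and> a \<in> ?P (init b m'))" for m m'
    proof (cases "m \<le> m'")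
      case True
      then obtain w where "init b m' = init b m @ w" using init_mono by blast
      then have "a \<in> P (init b m) \<Longrightarrow> a \<in> P (init b m' @ [])" using P(2)[of "init b m" w] by auto
      then show ?thesis by blast
    next
      case False
      then obtain w where "init b m = init b m' @ w" using init_mono[of m' m] by auto
      then show ?thesis by auto
    qed
    moreover obtain m where "a \<in> P (init b m) \<or> a \<in> ?P (init b m)" using gen[of 0] by auto
    ultimately show ?thesis unfolding Compl_iff Z' by blast
  qed
  then show "uniform_bp (- Z) ?P ?D"
    unfolding uniform_bp_def using P'_borel P'_mono D'_borel D'_dense by blast
qed

text \<open>Listing the requirements of all \<open>Z i\<close> through the pairing function gives
  one notion of genericity common to them all.\<close>

lemma uniform_bp_sequence:
  fixes Z :: "nat \<Rightarrow> (baire \<times> baire) set"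
  assumes "\<And>i. \<exists>P D. uniform_bp (Z i) P D"
  shows "\<exists>P D. \<forall>i. uniform_bp (Z i) (P i) D"
proof -
  from assms have "\<forall>i. \<exists>PD. uniform_bp (Z i) (fst PD) (snd PD)" by simp
  from choice[OF this] obtain PD where PD: "\<And>i. uniform_bp (Z i) (fst (PD i)) (snd (PD i))"
    by blast
  define P where "P i = fst (PD i)" for i
  define D where "D i = snd (PD i)" for i
  have U: "uniform_bp (Z i) (P i) (D i)" for i using PD by (simp add: P_def D_def)
  let ?D = "\<lambda>n. D (fst (prod_decode n)) (snd (prod_decode n))"
  have "uniform_bp (Z i) (P i) ?D" for i
    unfolding uniform_bp_def
  proof (intro conjI allI impI)
    fix a b assume "\<forall>n. \<exists>m. a \<in> ?D n (init b m)"
    then have "\<forall>n. \<exists>m. a \<in> D i n (init b m)"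
      by (metis fst_conv prod_encode_inverse snd_conv)
    then show "(a, b) \<in> Z i \<longleftrightarrow> (\<exists>m. a \<in> P i (init b m))"
      using U[of i] by (simp add: uniform_bp_def)
  qed (use U in \<open>simp_all add: uniform_bp_def\<close>)
  then show ?thesis by blast
qed

lemma uniform_bp_UN:
  fixes Z :: "nat \<Rightarrow> (baire \<times> baire) set"
  assumes "\<And>i. \<exists>P D. uniform_bp (Z i) P D"
  shows "\<exists>P D. uniform_bp (\<Union>i. Z i) P D"
proof -
  obtain P D where U: "\<And>i. uniform_bp (Z i) (P i) D" using uniform_bp_sequence[of Z] assms by blast
  have "uniform_bp (\<Union>i. Z i) (\<lambda>u. \<Union>i. P i u) D"
    unfolding uniform_bp_def
  proof (intro conjI allI impI)
    show "(\<Union>i. P i u) \<in> sets borel" for u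
      using U by (auto simp: uniform_bp_def intro!: sets.countable_UN)
    show "(\<Union>i. P i u) \<subseteq> (\<Union>i. P i (u @ w))" for u w
      using U by (intro UN_mono) (auto simp: uniform_bp_def)
    fix a b assume "\<forall>n. \<exists>m. a \<in> D n (init b m)"
    then have "(a, b) \<in> Z i \<longleftrightarrow> (\<exists>m. a \<in> P i (init b m))" for i
      using U by (simp add: uniform_bp_def)
    then show "(a, b) \<in> (\<Union>i. Z i) \<longleftrightarrow> (\<exists>m. a \<in> (\<Union>i. P i (init b m)))" by auto
  qed (use U in \<open>simp_all add: uniform_bp_def\<close>)
  then show ?thesis by blast
qed

lemma uniform_bp_borel:
  assumes "Z \<in> sets borel"
  shows "\<exists>P D. uniform_bp Z P D"
proof -
  have "Z \<in> sigma_sets UNIV {S. open S}" using assms by (simp add: borel_def)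
  then show ?thesis
  proof induction
    case (Basic Z)
    then show ?case by (simp add: uniform_bp_open)
  next
    case Empty
    then show ?case by (simp add: uniform_bp_open)
  next
    case (Compl Z)
    then show ?case using uniform_bp_Compl by (metis Compl_eq_Diff_UNIV)
  next
    case (Union Z)
    then show ?case by (intro uniform_bp_UN)
  qed
qed


section \<open>Generic pairs coding a given sequence\<close>

definition chain :: "(nat \<Rightarrow> 'a list) \<Rightarrow> bool" where
  "chain c \<longleftrightarrow> (\<forall>s. \<exists>w. w \<noteq> [] \<and> c (Suc s) = c s @ w)"

text \<open>Each step adds a letter, so position \<open>i\<close> is filled by stage
  \<open>Suc i\<close> at the latest.\<close>

definition chain_limit :: "(nat \<Rightarrow> 'a list) \<Rightarrow> nat \<Rightarrow> 'a" where
  "chain_limit c i = c (Suc i) ! i"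

lemma chain_le:
  assumes "chain c" "s \<le> t"
  shows "\<exists>w. c t = c s @ w"
  using assms(2)
proof (induction rule: dec_induct)
  case (step n)
  then show ?case using assms(1) unfolding chain_def by (metis append_assoc)
qed simp

lemma chain_length: "chain c \<Longrightarrow> s \<le> length (c s)"
proof (induction s)
  case (Suc s)
  then obtain w where "w \<noteq> []" "c (Suc s) = c s @ w" unfolding chain_def by blast
  then show ?case using Suc by (cases w) auto
qed simp

lemma chain_limit_nth:
  assumes "chain c" "i < length (c s)"
  shows "chain_limit c i = c s ! i"
proof (cases "s \<le> Suc i")
  case True
  then show ?thesis using chain_le[OF assms(1)] assms(2) unfolding chain_limit_def
    by (metis nth_append)
next
  case False
  then have "Suc i \<le> s" by simp
  from chain_le[OF assms(1) this] obtain w where w: "c s = c (Suc i) @ w" by blast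
  have "i < length (c (Suc i))" using chain_length[OF assms(1), of "Suc i"] by simp
  then show ?thesis by (simp add: chain_limit_def w nth_append)
qed

lemma init_chain_limit: "chain c \<Longrightarrow> init (chain_limit c) (length (c s)) = c s"
  by (auto simp: list_eq_iff_nth_eq chain_limit_nth)

section \<open>The alternating construction of two words from coded search results\<close>

definition entry :: "baire \<Rightarrow> nat \<Rightarrow> nat" where
  "entry y j = y (prod_encode (j, 0))"

text \<open>\<open>y\<close> will store searches as 0 for failure and \<open>Suc e\<close> for the
  witness \<open>e\<close>, hence the subtraction. Entry 0 is kept for the starting pair, so the
  search for \<open>(n, u)\<close> is shifted by one.\<close>

definition next_word :: "baire \<Rightarrow> nat \<Rightarrow> nat list \<Rightarrow> nat list" where
  "next_word y n u = from_nat (entry y (Suc (to_nat (n, u))) - 1)"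

definition first_words :: "baire \<Rightarrow> nat list \<times> nat list" where
  "first_words y = from_nat (entry y 0 - 1)"

text \<open>Each of the two words receives a letter that codes the current state of the other one; that
  is how the two limits together determine every stage.\<close>

definition extend_left :: "baire \<Rightarrow> baire \<Rightarrow> nat \<Rightarrow> nat list \<Rightarrow> nat list \<Rightarrow> nat list" where
  "extend_left y z s u v =
    (let u1 = u @ [to_nat (v, y s, z s)] in u1 @ next_word y s u1)"

definition extend_right :: "baire \<Rightarrow> nat \<Rightarrow> nat list \<Rightarrow> nat list \<Rightarrow> nat list" where
  "extend_right y s u v = (let v1 = v @ [to_nat u] in v1 @ next_word y s v1)"

text \<open>The right word answers the already extended left word, so its new letter reveals the
  next stage on the left.\<close>

primrec words :: "baire \<Rightarrow> baire \<Rightarrow> nat \<Rightarrow> nat list \<times> nat list" where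
  "words y z 0 = first_words y"
| "words y z (Suc s) =
    (let u = extend_left y z s (fst (words y z s)) (snd (words y z s))
     in (u, extend_right y s u (snd (words y z s))))"

definition left :: "baire \<Rightarrow> baire \<Rightarrow> baire" where
  "left y z = chain_limit (\<lambda>s. fst (words y z s))"

definition right :: "baire \<Rightarrow> baire \<Rightarrow> baire" where
  "right y z = chain_limit (\<lambda>s. snd (words y z s))"

lemma chain_words: "chain (\<lambda>s. fst (words y z s))" "chain (\<lambda>s. snd (words y z s))"
  by (auto simp: chain_def extend_left_def extend_right_def Let_def)

lemma init_left: "init (left y z) (length (fst (words y z s))) = fst (words y z s)"
  and init_right: "init (right y z) (length (snd (words y z s))) = snd (words y z s)"
  unfolding left_def right_def
  using init_chain_limit[OF chain_words(1)] init_chain_limit[OF chain_words(2)] by auto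

text \<open>With \<open>right_letter\<close> this forms a ladder: the letter after a left word
  reveals the right word of the same stage, and the letter after that one reveals the next left
  word.\<close>

lemma left_letter:
  "left y z (length (fst (words y z s))) = to_nat (snd (words y z s), y s, z s)"
  unfolding left_def
  by (subst chain_limit_nth[OF chain_words(1), where s = "Suc s"])
    (simp_all add: extend_left_def Let_def nth_append)

lemma right_letter:
  "right y z (length (snd (words y z s))) = to_nat (fst (words y z (Suc s)))"
  unfolding right_def
  by (subst chain_limit_nth[OF chain_words(2), where s = "Suc s"])
    (simp_all add: extend_right_def Let_def nth_append)

lemma left_0: "fst (first_words y) \<noteq> [] \<Longrightarrow> left y z 0 = hd (fst (first_words y))"
  and right_0: "snd (first_words y) \<noteq> [] \<Longrightarrow> right y z 0 = hd (snd (first_words y))"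
  unfolding left_def right_def
  by (simp_all add: chain_limit_nth[OF chain_words(1), where s = 0]
      chain_limit_nth[OF chain_words(2), where s = 0] hd_conv_nth)

text \<open>At stage \<open>Suc n\<close> both words end in an extension that \<open>y\<close>
  prescribes for requirement \<open>n\<close>.\<close>

lemma left_meets:
  assumes "\<And>u. a \<in> D n (u @ next_word y n u)"
  shows "\<exists>m. a \<in> D n (init (left y z) m)" "\<exists>m. a \<in> D n (init (right y z) m)"
proof -
  have "a \<in> D n (fst (words y z (Suc n)))" "a \<in> D n (snd (words y z (Suc n)))"
    using assms by (simp_all only: words.simps Let_def extend_left_def extend_right_def fst_conv snd_conv)
  then show "\<exists>m. a \<in> D n (init (left y z) m)" "\<exists>m. a \<in> D n (init (right y z) m)"
    using init_left init_right by metis+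
qed

text \<open>The first letter of \<open>v\<close> codes a list that contains \<open>u\<close>, at a position given by the first
  letter of \<open>u\<close>. So the two first letters determine \<open>u\<close>.\<close>

definition start_pair :: "nat list \<Rightarrow> nat list \<Rightarrow> bool" where
  "start_pair u v \<longleftrightarrow> u \<noteq> [] \<and> v \<noteq> [] \<and>
    (\<exists>(K :: nat list list) (L :: nat list list). hd u = to_nat K \<and> hd v = to_nat L \<and> length K < length L \<and> L ! length K = u)"

definition decode_start :: "nat \<Rightarrow> nat \<Rightarrow> nat list" where
  "decode_start i j = (from_nat j :: nat list list) ! length (from_nat i :: nat list list)"

lemma decode_start: "start_pair u v \<Longrightarrow> decode_start (hd u) (hd v) = u"
  by (auto simp: start_pair_def decode_start_def)

text \<open>The first letters code lists of different lengths. This separates the two ends of an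
  edge in a Borel way.\<close>

lemma start_pair_hd: "start_pair u v \<Longrightarrow> hd u \<noteq> hd v"
  by (auto simp: start_pair_def)

text \<open>Induction up the ladder of letters: a settled left word fixes a position of
  \<open>p\<close> that codes the right word and the values of \<open>Y\<close> and
  \<open>Z\<close>, and this right word fixes a position of \<open>q\<close> that codes the next
  left word. The first letters start the ladder. Convergence of \<open>Y\<close> and
  \<open>Z\<close> is thus obtained, not assumed.\<close>

lemma words_stabilize:
  fixes Y Z :: "nat \<Rightarrow> baire"
  assumes start: "\<And>k. start_pair (fst (first_words (Y k))) (snd (first_words (Y k)))"
    and p: "(\<lambda>k. left (Y k) (Z k)) \<longlonglongrightarrow> p" and q: "(\<lambda>k. right (Y k) (Z k)) \<longlonglongrightarrow> q"
  shows "\<exists>u v m n. \<forall>\<^sub>F k in sequentially. words (Y k) (Z k) s = (u, v) \<and> Y k s = m \<and> Z k s = n"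
proof -
  have P: "\<forall>\<^sub>F k in sequentially. left (Y k) (Z k) i = p i"
    and Q: "\<forall>\<^sub>F k in sequentially. right (Y k) (Z k) i = q i" for i
    using p q by (auto simp: tendsto_baire_iff)
  have step: "\<forall>\<^sub>F k in sequentially. (snd (words (Y k) (Z k) s), Y k s, Z k s) = from_nat (p (length u))"
    if "\<forall>\<^sub>F k in sequentially. fst (words (Y k) (Z k) s) = u" for s u
    using that P[of "length u"]
  proof eventually_elim
    case (elim k)
    then show ?case using left_letter[of "Y k" "Z k" s] by (metis from_nat_to_nat)
  qed
  have "\<exists>u. \<forall>\<^sub>F k in sequentially. fst (words (Y k) (Z k) s) = u"
  proof (induction s)
    case 0
    have "\<forall>\<^sub>F k in sequentially. fst (words (Y k) (Z k) 0) = decode_start (p 0) (q 0)"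
      using P[of 0] Q[of 0]
    proof eventually_elim
      case (elim k)
      have "left (Y k) (Z k) 0 = hd (fst (first_words (Y k)))"
        "right (Y k) (Z k) 0 = hd (snd (first_words (Y k)))"
        using start[of k] by (auto simp: start_pair_def intro: left_0 right_0)
      then show ?case using elim decode_start[OF start[of k]] by simp
    qed
    then show ?case by blast
  next
    case (Suc s)
    then obtain u where u: "\<forall>\<^sub>F k in sequentially. fst (words (Y k) (Z k) s) = u" by blast
    define v where "v = fst (from_nat (p (length u)) :: nat list \<times> nat \<times> nat)"
    have "\<forall>\<^sub>F k in sequentially. fst (words (Y k) (Z k) (Suc s)) = from_nat (q (length v))"
      using step[OF u] Q[of "length v"]
    proof eventually_elim
      case (elim k)
      then have "snd (words (Y k) (Z k) s) = v" unfolding v_def by (metis fst_conv)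
      then show ?case using right_letter[of "Y k" "Z k" s] elim(2) by (metis from_nat_to_nat)
    qed
    then show ?case by blast
  qed
  then obtain u where u: "\<forall>\<^sub>F k in sequentially. fst (words (Y k) (Z k) s) = u" by blast
  obtain v m n where vmn: "(from_nat (p (length u)) :: nat list \<times> nat \<times> nat) = (v, m, n)"
    using prod_cases3 by blast
  have "\<forall>\<^sub>F k in sequentially. words (Y k) (Z k) s = (u, v) \<and> Y k s = m \<and> Z k s = n"
    using u step[OF u] by eventually_elim (auto simp: vmn prod_eq_iff)
  then show ?thesis by blast
qed

text \<open>Each stage reads only finitely many letters of \<open>y\<close> and
  \<open>z\<close>.\<close>

lemma words_continuous:
  fixes Y Z :: "nat \<Rightarrow> baire"
  assumes "Y \<longlonglongrightarrow> y" "Z \<longlonglongrightarrow> z"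
  shows "\<forall>\<^sub>F k in sequentially. words (Y k) (Z k) s = words y z s"
proof -
  have Y: "\<forall>\<^sub>F k in sequentially. Y k i = y i" and Z: "\<forall>\<^sub>F k in sequentially. Z k i = z i" for i
    using assms by (auto simp: tendsto_baire_iff)
  have entry: "\<forall>\<^sub>F k in sequentially. entry (Y k) j = entry y j" for j
    unfolding entry_def by (rule Y)
  have next_word: "\<forall>\<^sub>F k in sequentially. next_word (Y k) n u = next_word y n u" for n u
    using entry[of "Suc (to_nat (n, u))"] by eventually_elim (simp add: next_word_def)
  show ?thesis
  proof (induction s)
    case 0
    show ?case using entry[of 0] by eventually_elim (simp add: first_words_def)
  next
    case (Suc s)
    obtain u v where uv: "words y z s = (u, v)" by fastforce
    define u' where "u' = extend_left y z s u v"
    show ?case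
      using Suc Y[of s] Z[of s] next_word[of s "u @ [to_nat (v, y s, z s)]"]
        next_word[of s "v @ [to_nat u']"]
    proof eventually_elim
      case (elim k)
      then have "extend_left (Y k) (Z k) s u v = u'"
        by (simp add: u'_def extend_left_def)
      moreover have "extend_right (Y k) s u' v = extend_right y s u' v"
        using elim by (simp add: extend_right_def)
      ultimately show ?case using elim by (simp add: uv Let_def flip: u'_def)
    qed
  qed
qed

lemma left_right_continuous:
  fixes Y Z :: "nat \<Rightarrow> baire"
  assumes "Y \<longlonglongrightarrow> y" "Z \<longlonglongrightarrow> z"
  shows "(\<lambda>k. left (Y k) (Z k)) \<longlonglongrightarrow> left y z" "(\<lambda>k. right (Y k) (Z k)) \<longlonglongrightarrow> right y z"
proof -
  have "\<forall>\<^sub>F k in sequentially. left (Y k) (Z k) i = left y z i \<and> right (Y k) (Z k) i = right y z i" for i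
    using words_continuous[OF assms, of "Suc i"]
    by eventually_elim (simp add: left_def right_def chain_limit_def del: words.simps)
  then show "(\<lambda>k. left (Y k) (Z k)) \<longlonglongrightarrow> left y z" "(\<lambda>k. right (Y k) (Z k)) \<longlonglongrightarrow> right y z"
    by (simp_all add: tendsto_baire_iff eventually_conj_iff)
qed

section \<open>The matching\<close>

lemma closed_matching:
  fixes g h :: "baire \<Rightarrow> baire"
  defines "b \<equiv> \<lambda>a. left (g a) (h a)" and "d \<equiv> \<lambda>a. right (g a) (h a)"
  assumes gh: "\<And>X a y z. X \<longlonglongrightarrow> a \<Longrightarrow> (\<lambda>k. g (X k)) \<longlonglongrightarrow> y \<Longrightarrow> (\<lambda>k. h (X k)) \<longlonglongrightarrow> z \<Longrightarrow>
      y = g a \<and> z = h a"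
    and start: "\<And>a. entry (g a) 0 \<noteq> 0 \<Longrightarrow> start_pair (fst (first_words (g a))) (snd (first_words (g a)))"
  shows "closed {(pr a (b a), pr a (d a)) | a. entry (g a) 0 \<noteq> 0}"
  unfolding closed_sequential_limits
proof (intro allI impI, elim conjE)
  fix E :: "nat \<Rightarrow> baire \<times> baire" and l
  assume "\<forall>k. E k \<in> {(pr a (b a), pr a (d a)) | a. entry (g a) 0 \<noteq> 0}" and E: "E \<longlonglongrightarrow> l"
  then have "\<forall>k. \<exists>a. E k = (pr a (b a), pr a (d a)) \<and> entry (g a) 0 \<noteq> 0" by simp
  from choice[OF this] obtain X
    where X: "\<And>k. E k = (pr (X k) (b (X k)), pr (X k) (d (X k)))" "\<And>k. entry (g (X k)) 0 \<noteq> 0"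
    by blast
  obtain x x' where l: "l = (x, x')" by fastforce
  have "(\<lambda>k. pr (X k) (b (X k))) \<longlonglongrightarrow> x" "(\<lambda>k. pr (X k) (d (X k))) \<longlonglongrightarrow> x'"
    using tendsto_fst[OF E] tendsto_snd[OF E] by (simp_all add: X(1) l)
  then have a: "X \<longlonglongrightarrow> prl x" and a': "X \<longlonglongrightarrow> prl x'"
    and p: "(\<lambda>k. b (X k)) \<longlonglongrightarrow> prr x" and q: "(\<lambda>k. d (X k)) \<longlonglongrightarrow> prr x'"
    by (simp_all add: tendsto_pr_iff)
  \<comment> \<open>Convergence of the two ends settles every stage, in particular all values of
    \<open>g\<close> and \<open>h\<close> along \<open>X\<close>.\<close>
  have stab: "\<forall>s. \<exists>uvmn. \<forall>\<^sub>F k in sequentially. words (g (X k)) (h (X k)) s = fst uvmn \<and>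
      g (X k) s = fst (snd uvmn) \<and> h (X k) s = snd (snd uvmn)"
    using words_stabilize[OF start[OF X(2)] p[unfolded b_def] q[unfolded d_def]] by simp
  from choice[OF this] obtain t where t: "\<And>s. \<forall>\<^sub>F k in sequentially. words (g (X k)) (h (X k)) s = fst (t s) \<and>
      g (X k) s = fst (snd (t s)) \<and> h (X k) s = snd (snd (t s))"
    by blast
  have y: "(\<lambda>k. g (X k)) \<longlonglongrightarrow> (\<lambda>s. fst (snd (t s)))" and z: "(\<lambda>k. h (X k)) \<longlonglongrightarrow> (\<lambda>s. snd (snd (t s)))"
    unfolding tendsto_baire_iff using t by (simp_all add: eventually_conj_iff)
  define a where "a = prl x"
  \<comment> \<open>The closed graph of \<open>(g, h)\<close> identifies these limits as the values
    at \<open>a\<close>; continuity of the construction then identifies the limits of the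
    ends.\<close>
  have g: "(\<lambda>k. g (X k)) \<longlonglongrightarrow> g a" and h: "(\<lambda>k. h (X k)) \<longlonglongrightarrow> h a"
    using gh[OF a y z] y z by (auto simp: a_def)
  have "prr x = b a" "prr x' = d a"
    using left_right_continuous[OF g h] p q baire_limit_unique unfolding b_def d_def by blast+
  moreover have "prl x' = a" using a a' baire_limit_unique by (auto simp: a_def)
  ultimately have "x = pr a (b a)" "x' = pr a (d a)"
    by (auto intro: prl_prr_eqI simp: a_def)
  moreover have "entry (g a) 0 \<noteq> 0"
  proof -
    \<comment> \<open>The entry takes discrete values, so being nonzero survives in the
      limit.\<close>
    have "\<forall>\<^sub>F k in sequentially. entry (g (X k)) 0 = entry (g a) 0"
      using g by (simp add: tendsto_baire_iff entry_def)
    then obtain k where "entry (g (X k)) 0 = entry (g a) 0"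
      using eventually_happens'[OF sequentially_bot] by blast
    with X(2)[of k] show ?thesis by simp
  qed
  ultimately show "l \<in> {(pr a (b a), pr a (d a)) | a. entry (g a) 0 \<noteq> 0}"
    unfolding l by blast
qed

lemma generic_extension:
  fixes D :: "nat \<Rightarrow> nat list \<Rightarrow> 'a set"
  assumes "\<And>n u. \<exists>w. a \<in> D n (u @ w)"
  shows "\<exists>b. b \<in> cyl u \<and> (\<forall>n. \<exists>m. a \<in> D n (init b m))"
proof -
  have "\<forall>n u. \<exists>w. a \<in> D n (u @ w)" using assms by blast
  then obtain w where w: "\<And>n u. a \<in> D n (u @ w n u)" by metis
  \<comment> \<open>The letter 0 makes every step proper even if the word chosen to enter
    \<open>D n\<close> is empty.\<close>
  define c where "c = rec_nat u (\<lambda>n v. v @ [0] @ w n (v @ [0]))"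
  have c: "c 0 = u" "\<And>n. c (Suc n) = (c n @ [0]) @ w n (c n @ [0])" by (simp_all add: c_def)
  then have chain: "chain c" by (auto simp: chain_def)
  have "a \<in> D n (init (chain_limit c) (length (c (Suc n))))" for n
    unfolding init_chain_limit[OF chain] unfolding c(2) by (rule w)
  moreover have "chain_limit c \<in> cyl u"
    using init_chain_limit[OF chain, of 0] by (simp add: cyl_def c(1))
  ultimately show ?thesis by blast
qed

lemma ex_start_pair:
  fixes P :: "nat \<Rightarrow> nat list \<Rightarrow> 'a set"
  assumes "\<And>i. \<exists>k<N. \<exists>u. u \<noteq> [] \<and> hd u = i \<and> a \<in> P k u"
  shows "\<exists>u v k. start_pair u v \<and> a \<in> P k u \<and> a \<in> P k v"
proof -
  \<comment> \<open>Each word begins with the code of the list of its predecessors, so an earlier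
    and a later word always form a starting pair. Pigeonhole on \<open>N + 1\<close> words with
    \<open>N\<close> colours then gives two of the same colour.\<close>
  have "\<exists>L :: nat list list. length L = n \<and>
      (\<forall>q<n. L ! q \<noteq> [] \<and> hd (L ! q) = to_nat (take q L) \<and> (\<exists>k<N. a \<in> P k (L ! q)))" for n
  proof (induction n)
    case (Suc n)
    then obtain L :: "nat list list" where L: "length L = n"
      "\<And>q. q < n \<Longrightarrow> L ! q \<noteq> [] \<and> hd (L ! q) = to_nat (take q L) \<and> (\<exists>k<N. a \<in> P k (L ! q))"
      by blast
    obtain k u where "k < N" "u \<noteq> []" "hd u = to_nat L" "a \<in> P k u" using assms by metis
    with L show ?case
      by (intro exI[of _ "L @ [u]"]) (auto simp: less_Suc_eq nth_append)
  qed simp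
  then obtain L :: "nat list list" where L: "length L = Suc N"
    "\<And>q. q < Suc N \<Longrightarrow> L ! q \<noteq> [] \<and> hd (L ! q) = to_nat (take q L) \<and> (\<exists>k<N. a \<in> P k (L ! q))"
    by blast
  then have "\<forall>q\<in>{..<Suc N}. \<exists>k<N. a \<in> P k (L ! q)" by blast
  from bchoice[OF this] obtain K where K: "\<And>q. q < Suc N \<Longrightarrow> K q < N \<and> a \<in> P (K q) (L ! q)"
    by blast
  have "\<not> inj_on K {..<Suc N}"
  proof
    assume "inj_on K {..<Suc N}"
    moreover have "K ` {..<Suc N} \<subseteq> {..<N}" using K by auto
    ultimately have "card {..<Suc N} \<le> card {..<N}" by (intro card_inj_on_le) auto
    then show False by simp
  qed
  then obtain p q where "p < q" "q < Suc N" "K p = K q"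
    unfolding inj_on_def by (metis lessThan_iff linorder_neqE_nat)
  \<comment> \<open>The witnesses are the two lists of predecessors; entry \<open>p\<close> of
    \<open>take q L\<close> is \<open>L ! p\<close>.\<close>
  then have "start_pair (L ! p) (L ! q)"
    unfolding start_pair_def using L
    by (intro conjI exI[of _ "take p L"] exI[of _ "take q L"]) auto
  moreover have "a \<in> P (K p) (L ! p)" "a \<in> P (K p) (L ! q)"
    using K[of p] K[of q] \<open>p < q\<close> \<open>q < Suc N\<close> \<open>K p = K q\<close> by auto
  ultimately show ?thesis by blast
qed

lemma ex_matching:
  assumes U: "U \<in> sets (borel :: (baire \<times> baire) measure)"
  shows "\<exists>G b d. closed {(pr a (b a), pr a (d a)) | a. a \<in> G} \<and>
    (\<exists>S \<in> sets (borel :: baire measure). \<forall>a\<in>G. pr a (b a) \<in> S \<and> pr a (d a) \<notin> S) \<and>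
    (\<forall>a (c :: baire \<Rightarrow> nat) N. range c \<subseteq> {..<N} \<longrightarrow> (\<forall>x k. c x = k \<longleftrightarrow> (slice a k, x) \<in> U) \<longrightarrow>
      a \<in> G \<and> c (pr a (b a)) = c (pr a (d a)))"
proof -
  \<comment> \<open>The diagonal step: \<open>a\<close> is both the code of the colouring and the
    left half of the points that it colours.\<close>
  define Z where "Z k = {e :: baire \<times> baire. (slice (fst e) k, pr (fst e) (snd e)) \<in> U}" for k
  have "Z k \<in> sets borel" for k
    unfolding Z_def by (intro borel_continuous_vimage[OF _ U] continuous_intros continuous_on_id)
  then obtain P D where PD: "\<And>k. uniform_bp (Z k) (P k) D"
    using uniform_bp_sequence[of Z] uniform_bp_borel by blast
  have P: "P k u \<in> sets borel" "P k u \<subseteq> P k (u @ w)" for k u w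
    using PD by (auto simp: uniform_bp_def)
  have D: "D n u \<in> sets borel" "\<exists>w. a \<in> D n (u @ w)" for n u a
    using PD by (auto simp: uniform_bp_def)
  have Z: "(a, x) \<in> Z k \<longleftrightarrow> (\<exists>m. a \<in> P k (init x m))" if "\<And>n. \<exists>m. a \<in> D n (init x m)" for a x k
    using PD that by (auto simp: uniform_bp_def)
  define pair where "pair e = (from_nat e :: nat list \<times> nat list)" for e
  \<comment> \<open>The parameters for which \<open>e\<close> codes a starting pair whose words
    force a common colour.\<close>
  define S0 where "S0 e = {a. start_pair (fst (pair e)) (snd (pair e)) \<and>
      (\<exists>k. a \<in> P k (fst (pair e)) \<and> a \<in> P k (snd (pair e)))}" for e
  have S0: "S0 e \<in> sets borel" for e
    unfolding S0_def by (intro borel_Conj borel_const borel_Ex) (simp_all add: P)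
  \<comment> \<open>All searches in one table, laid out as \<open>first_words\<close> and
    \<open>next_word\<close> read it; \<open>g\<close> records the least witness of each.\<close>
  define T where "T j e = (case j of 0 \<Rightarrow> S0 e
      | Suc i \<Rightarrow> case from_nat i of (n, u) \<Rightarrow> D n (u @ from_nat e))" for j e
  have T: "T j e \<in> sets borel" for j e
    by (auto simp: T_def S0 D split: nat.split prod.split)
  define g where "g a = unslices (\<lambda>j. first_index (T j) a)" for a
  have "refinable g"
    unfolding g_def by (intro refinable_slices refinable_first_index refinable_indic_borel T)
  then obtain h :: "baire \<Rightarrow> baire" where gh: "\<And>X a y z. X \<longlonglongrightarrow> a \<Longrightarrow> (\<lambda>k. g (X k)) \<longlonglongrightarrow> y \<Longrightarrow> (\<lambda>k. h (X k)) \<longlonglongrightarrow> z \<Longrightarrow>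
      y = g a \<and> z = h a"
    unfolding refinable_def by blast
  have entry: "entry (g a) j = (if \<exists>e. a \<in> T j e then Suc (LEAST e. a \<in> T j e) else 0)" for a j
    by (simp add: g_def entry_def unslices_def first_index_def)
  have entry_T: "a \<in> T j (entry (g a) j - 1)" if "a \<in> T j e" for a j e
    using that by (auto simp: entry intro: LeastI)
  define G where "G = {a. entry (g a) 0 \<noteq> 0}"
  have G: "a \<in> S0 (entry (g a) 0 - 1)" if "a \<in> G" for a
  proof -
    have "\<exists>e. a \<in> T 0 e" using that unfolding G_def entry by (auto split: if_splits)
    then obtain e where "a \<in> T 0 e" ..
    from entry_T[OF this] show ?thesis by (simp add: T_def)
  qed
  have start: "start_pair (fst (first_words (g a))) (snd (first_words (g a)))" if "a \<in> G" for a
    using G[OF that] by (simp add: S0_def first_words_def pair_def)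
  define b where "b a = left (g a) (h a)" for a
  define d where "d a = right (g a) (h a)" for a
  have dense: "a \<in> D n (u @ next_word (g a) n u)" for a n u
  proof -
    obtain w where "a \<in> D n (u @ w)" using D(2) by blast
    then have "a \<in> T (Suc (to_nat (n, u))) (to_nat w)" by (simp add: T_def)
    from entry_T[OF this] show ?thesis by (simp add: T_def next_word_def)
  qed
  have gen: "\<exists>m. a \<in> D n (init (b a) m)" "\<exists>m. a \<in> D n (init (d a) m)" for a n
    unfolding b_def d_def by (rule left_meets[of a D n, OF dense])+
  have "closed {(pr a (b a), pr a (d a)) | a. entry (g a) 0 \<noteq> 0}"
    unfolding b_def d_def by (rule closed_matching[OF gh]) (use start in \<open>auto simp: G_def\<close>)
  then have "closed {(pr a (b a), pr a (d a)) | a. a \<in> G}" by (simp add: G_def)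
  moreover have "\<exists>S \<in> sets (borel :: baire measure). \<forall>a\<in>G. pr a (b a) \<in> S \<and> pr a (d a) \<notin> S"
  proof (intro bexI ballI)
    \<comment> \<open>\<open>?W e\<close> fixes the least starting pair of a parameter. A point of
      \<open>?S\<close> has a right half that begins like the first word of that pair, while
      \<open>d a\<close> begins like the second word.\<close>
    let ?W = "\<lambda>e. {a. a \<in> T 0 e \<and> (\<forall>e'. e' < e \<longrightarrow> \<not> a \<in> T 0 e')}"
    let ?S = "{x. \<exists>e. prl x \<in> ?W e \<and> prr x 0 = hd (fst (pair e))}"
    have W: "?W e \<in> sets borel" for e
      by (intro borel_Conj borel_All borel_Imp borel_Not borel_const) (simp_all add: T)
    show "?S \<in> sets borel"
      by (intro borel_Ex borel_Conj borel_continuous_vimage[OF _ W] continuous_intros continuous_on_id)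
        (simp add: prr_def open_coord_vimage)
    fix a assume a: "a \<in> G"
    define e where "e = entry (g a) 0 - 1"
    have e: "a \<in> ?W e' \<longleftrightarrow> e' = e" for e'
    proof -
      have ex: "\<exists>e. a \<in> T 0 e" using a unfolding G_def entry by (auto split: if_splits)
      then have e: "e = (LEAST e. a \<in> T 0 e)" by (simp add: e_def entry)
      have "a \<in> T 0 e" unfolding e by (rule LeastI_ex[OF ex])
      moreover have "a \<notin> T 0 m" if "m < e" for m
        using that unfolding e by (rule not_less_Least)
      ultimately show ?thesis using linorder_neqE_nat[of e' e] by blast
    qed
    have "b a 0 = hd (fst (pair e))"
      "d a 0 = hd (snd (pair e))"
      using start[OF a] left_0[of "g a" "h a"] right_0[of "g a" "h a"]
      by (auto simp: b_def d_def e_def first_words_def pair_def start_pair_def)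
    moreover have "hd (fst (pair e)) \<noteq> hd (snd (pair e))"
      using start_pair_hd[OF start[OF a]] by (simp add: e_def first_words_def pair_def)
    ultimately show "pr a (b a) \<in> ?S \<and> pr a (d a) \<notin> ?S"
      unfolding mem_Collect_eq prl_pr prr_pr e[unfolded mem_Collect_eq] by auto
  qed
  moreover have "a \<in> G \<and> c (pr a (b a)) = c (pr a (d a))"
    if N: "range c \<subseteq> {..<N}" and c: "\<forall>x k. c x = k \<longleftrightarrow> (slice a k, x) \<in> U"
    for a and c :: "baire \<Rightarrow> nat" and N
  proof -
    have cZ: "(a, x) \<in> Z k \<longleftrightarrow> c (pr a x) = k" for x k using c by (simp add: Z_def)
    \<comment> \<open>A generic point with first letter \<open>i\<close> has some colour, and one of
      its initial segments forces this colour.\<close>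
    have "\<exists>k<N. \<exists>u. u \<noteq> [] \<and> hd u = i \<and> a \<in> P k u" for i
    proof -
      obtain x where x: "x \<in> cyl [i]" "\<And>n. \<exists>m. a \<in> D n (init x m)"
        using generic_extension[of a D "[i]"] D(2) by blast
      let ?k = "c (pr a x)"
      have "?k < N" using N by auto
      obtain m where "a \<in> P ?k (init x m)" using Z[OF x(2)] cZ by blast
      \<comment> \<open>One more letter ensures that the segment is nonempty with head
        \<open>i\<close>; \<open>P\<close> persists under extension.\<close>
      moreover obtain w where "init x (Suc m) = init x m @ w" using init_mono[of m "Suc m"] by auto
      ultimately have "a \<in> P ?k (init x (Suc m))" using P(2) by auto
      moreover have "init x (Suc m) \<noteq> []" "hd (init x (Suc m)) = i"
        using x(1) by (auto simp: cyl_iff hd_conv_nth simp flip: length_greater_0_conv)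
      ultimately show ?thesis using \<open>?k < N\<close> by blast
    qed
    then obtain u v k where uv: "start_pair u v" "a \<in> P k u" "a \<in> P k v"
      using ex_start_pair[of N a P] by blast
    then have "a \<in> T 0 (to_nat (u, v))" by (auto simp: T_def S0_def pair_def)
    then have "a \<in> G" by (auto simp: G_def entry)
    \<comment> \<open>The least pair recorded by \<open>g\<close> may differ from
      \<open>(u, v)\<close>, so its common colour is obtained afresh.\<close>
    from G[OF this] obtain k where "a \<in> P k (fst (first_words (g a)))" "a \<in> P k (snd (first_words (g a)))"
      by (auto simp: S0_def first_words_def pair_def)
    then have "\<exists>m. a \<in> P k (init (b a) m)" "\<exists>m. a \<in> P k (init (d a) m)"
      using init_left[of "g a" "h a" 0] init_right[of "g a" "h a" 0] unfolding b_def d_def words.simps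
      by metis+
    \<comment> \<open>Both ends are generic and extend words that force \<open>k\<close>.\<close>
    then have "(a, b a) \<in> Z k" "(a, d a) \<in> Z k" using Z gen by blast+
    with \<open>a \<in> G\<close> show ?thesis by (simp add: cZ)
  qed
  ultimately show ?thesis by blast
qed


section \<open>Chromatic numbers\<close>

lemma chromatic_number_two:
  fixes E :: "(baire \<times> baire) set"
  assumes "E \<noteq> {}" "S \<in> sets borel" "\<And>x y. (x, y) \<in> E \<Longrightarrow> x \<in> S \<and> y \<notin> S"
  shows "has_chromatic_number (sets borel) E ctwo"
  unfolding has_chromatic_number_def
proof (intro conjI exI allI impI)
  obtain x y where xy: "(x, y) \<in> E" using assms(1) by auto
  let ?c = "\<lambda>x. if x \<in> S then 1 else 0 :: nat"
  have "?c -` {k} = (if k = 1 then S else if k = 0 then - S else {})" for k by auto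
  then have "?c -` {k} \<in> sets borel" for k using assms(2) by auto
  then show "meas_coloring (sets borel) E ?c"
    using assms(3) by (auto simp: meas_coloring_def coloring_def)
  have "range ?c = {0, 1}" using assms(3)[OF xy] by (auto simp: image_iff)
  then have "bij_betw (\<lambda>n. n = 1) (range ?c) (UNIV :: bool set)"
    by (auto simp: bij_betw_def inj_on_def)
  then show "|range ?c| =o ctwo"
    unfolding ctwo_def using card_of_ordIso by blast
  fix c :: "baire \<Rightarrow> nat" assume "meas_coloring (sets borel) E c"
  then have "c x \<noteq> c y" using xy by (auto simp: meas_coloring_def coloring_def)
  then have "inj_on (\<lambda>b. if b then c x else c y) UNIV" by (auto simp: inj_on_def)
  then show "ctwo \<le>o |range c|"
    unfolding ctwo_def by (intro card_of_ordLeq[THEN iffD1] exI conjI) auto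
qed

text \<open>Colour a point by its shortest initial segment whose cylinder spans no edge; it exists
  because \<open>E\<close> is closed and misses the diagonal.\<close>

lemma ex_clopen_coloring:
  fixes E :: "(baire \<times> baire) set"
  assumes "closed E" "\<And>x. (x, x) \<notin> E"
  shows "\<exists>c :: baire \<Rightarrow> nat. coloring E c \<and> (\<forall>k. open (c -` {k}) \<and> closed (c -` {k}))"
proof -
  define N where "N x = (LEAST n. cyl (init x n) \<times> cyl (init x n) \<subseteq> - E)" for x
  define c :: "baire \<Rightarrow> nat" where "c x = to_nat (init x (N x))" for x
  have N: "cyl (init x (N x)) \<times> cyl (init x (N x)) \<subseteq> - E" for x
  proof -
    obtain m n where mn: "cyl (init x m) \<times> cyl (init x n) \<subseteq> - E"
      using open_prod_contains_cyl[of "- E" x x] assms by auto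
    have "cyl (init x (max m n)) \<subseteq> cyl (init x m) \<inter> cyl (init x n)" by (auto simp: cyl_iff)
    with mn have "cyl (init x (max m n)) \<times> cyl (init x (max m n)) \<subseteq> - E" by blast
    then show ?thesis unfolding N_def by (rule LeastI)
  qed
  \<comment> \<open>Up to length \<open>N x\<close> the points \<open>x\<close> and \<open>y\<close>
    have the same segments, so the search stops at the same one.\<close>
  have local: "c y = c x" if "y \<in> cyl (init x (N x))" for x y
  proof -
    have eq: "init y n = init x n" if "n \<le> N x" for n
      using \<open>y \<in> cyl (init x (N x))\<close> that by (auto simp: cyl_iff list_eq_iff_nth_eq)
    have "N y = N x"
      unfolding N_def[of y]
    proof (rule Least_equality)
      show "cyl (init y (N x)) \<times> cyl (init y (N x)) \<subseteq> - E" using N[of x] by (simp add: eq)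
      fix n assume n: "cyl (init y n) \<times> cyl (init y n) \<subseteq> - E"
      show "N x \<le> n"
      proof (rule ccontr)
        assume "\<not> N x \<le> n"
        then have "cyl (init x n) \<times> cyl (init x n) \<subseteq> - E" using n eq[of n] by simp
        then have "N x \<le> n" unfolding N_def by (rule Least_le)
        with \<open>\<not> N x \<le> n\<close> show False ..
      qed
    qed
    then show ?thesis by (simp add: c_def eq)
  qed
  have "open (c -` K)" for K
  proof -
    have "c -` K = (\<Union>x\<in>c -` K. cyl (init x (N x)))" using local by auto
    then show ?thesis by (metis open_UN open_cyl)
  qed
  then have "open (c -` {k}) \<and> closed (c -` {k})" for k
    by (auto simp: closed_def simp flip: vimage_Compl)
  moreover have "coloring E c"
    unfolding coloring_def
  proof clarify
    fix x y assume xy: "(x, y) \<in> E" "c x = c y"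
    then have "init x (N x) = init y (N y)" by (simp add: c_def)
    then have "(x, y) \<in> cyl (init x (N x)) \<times> cyl (init x (N x))" using mem_cyl_init[of x "N x"] mem_cyl_init[of y "N y"] by simp
    with N[of x] xy(1) show False by blast
  qed
  ultimately show ?thesis by blast
qed

lemma chromatic_number_aleph0:
  fixes E :: "(baire \<times> baire) set"
  assumes "Well_order \<xi>" "Field \<xi> \<noteq> {}" "closed E" "\<And>x. (x, x) \<notin> E"
    and fin: "\<not> has_finite_coloring (Delta0 \<xi>) E"
  shows "has_chromatic_number (Delta0 \<xi>) E natLeq"
proof -
  have inf: "infinite (range c)" if "meas_coloring (Delta0 \<xi>) E c" for c :: "baire \<Rightarrow> nat"
  proof
    assume "finite (range c)"
    then obtain n where "range c \<subseteq> {0..<n}"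
      by (metis atLeast0LessThan finite_nat_iff_bounded)
    with that fin show False by (auto simp: has_finite_coloring_def)
  qed
  obtain c :: "baire \<Rightarrow> nat" where c: "coloring E c" "\<And>k. open (c -` {k}) \<and> closed (c -` {k})"
    using ex_clopen_coloring[OF assms(3,4)] by blast
  then have mc: "meas_coloring (Delta0 \<xi>) E c"
    unfolding meas_coloring_def using Delta0_clopen[OF assms(1,2)] by blast
  have "|range c| \<le>o |UNIV :: nat set|" by (rule card_of_mono1) simp
  then have "|range c| \<le>o natLeq" using card_of_nat ordLeq_ordIso_trans by blast
  moreover have lower: "natLeq \<le>o |range c|" if "meas_coloring (Delta0 \<xi>) E c" for c :: "baire \<Rightarrow> nat"
    using inf[OF that] infinite_iff_natLeq_ordLeq by blast
  ultimately have "|range c| =o natLeq" using mc ordIso_iff_ordLeq by blast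
  with mc lower show ?thesis unfolding has_chromatic_number_def by blast
qed

theorem mainTheorem1:
  fixes \<xi> :: "nat rel"
  assumes "Well_order \<xi>" and "Field \<xi> \<noteq> {}"
  shows "\<exists>f :: baire \<rightharpoonup> baire.
    inj_on f (dom f) \<and> dom f \<inter> ran f = {} \<and> closed (Map.graph f) \<and>
    \<not> has_finite_coloring (Delta0 \<xi>) (Map.graph f) \<and>
    has_chromatic_number (sets borel) (Map.graph f) ctwo \<and>
    has_chromatic_number (Delta0 \<xi>) (Map.graph f) natLeq"
proof -
  obtain U :: "(baire \<times> baire) set" where U: "U \<in> sets borel"
    "\<And>A. Sigma0 \<xi> A \<Longrightarrow> \<exists>a. A = {x. (a, x) \<in> U}"
    using parametrizable_Sigma0[of \<xi>] unfolding parametrizable_def by blast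
  obtain G b d S where closed: "closed {(pr a (b a), pr a (d a)) | a. a \<in> G}"
    and S: "S \<in> sets (borel :: baire measure)" "\<And>a. a \<in> G \<Longrightarrow> pr a (b a) \<in> S \<and> pr a (d a) \<notin> S"
    and mono: "\<And>a (c :: baire \<Rightarrow> nat) N. range c \<subseteq> {..<N} \<Longrightarrow>
      (\<forall>x k. c x = k \<longleftrightarrow> (slice a k, x) \<in> U) \<Longrightarrow> a \<in> G \<and> c (pr a (b a)) = c (pr a (d a))"
    using ex_matching[OF U(1)] by blast
  define f where "f x = (if prl x \<in> G \<and> prr x = b (prl x) then Some (pr (prl x) (d (prl x))) else None)" for x
  have f: "f x = Some y \<longleftrightarrow> (\<exists>a\<in>G. x = pr a (b a) \<and> y = pr a (d a))" for x y
    using prl_prr_eqI[of x "prl x" "b (prl x)"] by (auto simp: f_def)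
  then have graph: "Map.graph f = {(pr a (b a), pr a (d a)) | a. a \<in> G}"
    by (auto simp: Map.graph_def)
  have inj: "inj_on f (dom f)"
  proof (rule inj_onI)
    fix x y assume "x \<in> dom f" "f x = f y"
    then obtain z where "f x = Some z" by blast
    moreover from this have "f y = Some z" using \<open>f x = f y\<close> by simp
    ultimately show "x = y" by (auto simp: f)
  qed
  \<comment> \<open>\<open>S\<close> separates the ends of every edge: this yields disjointness of
    domain and range, absence of loops and the Borel colouring with two colours.\<close>
  have in_S: "x \<in> S \<and> y \<notin> S" if "(x, y) \<in> Map.graph f" for x y
    using that S(2) by (auto simp: graph)
  have disj: "dom f \<inter> ran f = {}"
    using in_S unfolding dom_def ran_def Map.graph_def by blast
  have fin: "\<not> has_finite_coloring (Delta0 \<xi>) (Map.graph f)"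
  proof
    assume "has_finite_coloring (Delta0 \<xi>) (Map.graph f)"
    then obtain n and c :: "baire \<Rightarrow> nat" where c: "range c \<subseteq> {..<n}"
      "\<And>k. Sigma0 \<xi> (c -` {k})" "coloring (Map.graph f) c"
      by (auto simp: has_finite_coloring_def meas_coloring_def Delta0_def atLeast0LessThan)
    \<comment> \<open>The codes of all colour classes are joined into one parameter, over which lies
      an edge with ends of equal colour.\<close>
    have "\<forall>k. \<exists>a. c -` {k} = {x. (a, x) \<in> U}" using U(2) c(2) by blast
    from choice[OF this] obtain a where a: "\<And>k. c -` {k} = {x. (a k, x) \<in> U}" by blast
    have "c x = k \<longleftrightarrow> (slice (unslices a) k, x) \<in> U" for x k
      using a[of k] by auto
    then have *: "unslices a \<in> G" "c (pr (unslices a) (b (unslices a))) = c (pr (unslices a) (d (unslices a)))"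
      using mono[OF c(1), of "unslices a"] by blast+
    then have "(pr (unslices a) (b (unslices a)), pr (unslices a) (d (unslices a))) \<in> Map.graph f"
      unfolding graph by blast
    with c(3) *(2) show False by (auto simp: coloring_def)
  qed
  \<comment> \<open>Without edges, the constant map would be a finite colouring.\<close>
  have "Map.graph f \<noteq> {}"
  proof
    assume empty: "Map.graph f = {}"
    have "(UNIV :: baire set) \<in> Delta0 \<xi>" "({} :: baire set) \<in> Delta0 \<xi>"
      by (intro Delta0_clopen[OF assms]; simp)+
    then have "(\<lambda>_ :: baire. 0 :: nat) -` {k} \<in> Delta0 \<xi>" for k by (simp add: vimage_const)
    then have "meas_coloring (Delta0 \<xi>) (Map.graph f) (\<lambda>_. 0 :: nat)"
      unfolding meas_coloring_def coloring_def empty by blast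
    moreover have "range (\<lambda>_ :: baire. 0 :: nat) \<subseteq> {0..<1}" by simp
    ultimately have "has_finite_coloring (Delta0 \<xi>) (Map.graph f)"
      unfolding has_finite_coloring_def by blast
    with fin show False ..
  qed
  then have "has_chromatic_number (sets borel) (Map.graph f) ctwo"
    using S(1) in_S by (rule chromatic_number_two)
  moreover have "has_chromatic_number (Delta0 \<xi>) (Map.graph f) natLeq"
    using assms closed[folded graph] _ fin by (rule chromatic_number_aleph0) (use in_S in blast)
  ultimately show ?thesis using inj disj closed[folded graph] fin by blast
qed

end
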